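(* The following ternary quadratic forms represent every positive integer coprime to the indicated prime $p$: for $p=5$: $x^2+5xz+2y^2+yz+7z^2$, $x^2+4xz+2y^2+3yz+7z^2$, $x^2+4xz+2y^2+2yz+7z^2$, $x^2+2y^2+4yz+7z^2$, $x^2+xy+2xz+2y^2+3yz+3z^2$, $x^2+xy+2y^2+yz+3z^2$; for $p=7$: $x^2+4xz+2y^2+yz+5z^2$, $x^2+3xz+2y^2+yz+5z^2$; for $p=11$: $x^2+xz+y^2+3z^2$; for $p=13$: $x^2+3xz+2y^2+3yz+5z^2$; for $p=17$: $x^2+xy+xz+2y^2+2yz+3z^2$. Moreover, if $p=19$ or $p=37$, there is no positive-definite integral ternary quadratic form representing every positive integer coprime to $p$.
   Context: A quadratic form $Q(x)=\frac12 x^tAx$ is integral if $A$ is a symmetric integer matrix with even diagonal (i.e. $Q$ has integer coefficients); ternary means three variables. $Q$ represents $n$ if $Q(x)=n$ for some integer vector $x$. *)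

theory Defs
  imports "HOL-Analysis.Analysis"
begin

definition even_symmetric_matrix :: "int ^ 'n ^ 'n::finite \<Rightarrow> bool" where
  "even_symmetric_matrix A \<longleftrightarrow> transpose A = A \<and> (\<forall>i. even (A $ i $ i))"

text \<open>Forms are functions on real (not integer) vectors so that positive definiteness is over the reals.\<close>

definition integral_quadratic_form :: "(real ^ 'n::finite \<Rightarrow> real) \<Rightarrow> bool" where
  "integral_quadratic_form Q \<longleftrightarrow>
     (\<exists>A :: int ^ 'n ^ 'n. even_symmetric_matrix A \<and>
        Q = (\<lambda>x. 1 / 2 * (x \<bullet> (map_matrix real_of_int A *v x))))"

definition positive_definite :: "(real ^ 'n::finite \<Rightarrow> real) \<Rightarrow> bool" where
  "positive_definite Q \<longleftrightarrow> (\<forall>x. x \<noteq> 0 \<longrightarrow> Q x > 0)"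

definition represents :: "(real ^ 'n::finite \<Rightarrow> real) \<Rightarrow> nat \<Rightarrow> bool" where
  "represents Q n \<longleftrightarrow> (\<exists>x :: int ^ 'n. Q (\<chi> i. real_of_int (x $ i)) = real n)"

definition represents_all_coprime_to :: "nat \<Rightarrow> (real ^ 'n::finite \<Rightarrow> real) \<Rightarrow> bool" where
  "represents_all_coprime_to p Q \<longleftrightarrow> (\<forall>n > 0. coprime n p \<longrightarrow> represents Q n)"

definition in_xyz :: "(real \<Rightarrow> real \<Rightarrow> real \<Rightarrow> real) \<Rightarrow> real ^ 3 \<Rightarrow> real" where
  "in_xyz f v = f (v $ 1) (v $ 2) (v $ 3)"

end

theory Submission
  imports Defs "HOL-Number_Theory.Number_Theory" "HOL-Computational_Algebra.Squarefree"
begin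

text \<open>
  Let \<open>p\<close> be the prime in question, \<open>D\<close> half the determinant of the Gram matrix, and \<open>n\<close> coprime to \<open>p\<close>,
  without loss of generality squarefree. A form of half-discriminant \<open>D\<close> representing \<open>n\<close> as its first
  coefficient amounts to a binary form \<open>h\<close> of discriminant \<open>-16 n D\<close> such that \<open>-h\<close> is the square of a
  linear form modulo \<open>4 n\<close>. Such an \<open>h\<close> with prime first coefficient \<open>q\<close> exists as soon as \<open>-q\<close> is a
  square modulo \<open>4 n\<close> and \<open>-n D\<close> is a square modulo \<open>q\<close>. By quadratic reciprocity this only prescribes
  finitely many quadratic characters of \<open>q\<close>, so that Dirichlet's argument is needed for real characters
  only. The resulting form is anisotropic at \<open>p\<close>, and by Hermite reduction it is equivalent to one of
  finitely many reduced forms. The target form represents everything these represent: they are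
  equivalent to it, or every integer vector lies in a sublattice that is similar to one of the target lattice.

  For the negative part, a positive form representing 1, 2, 3 and 5 has only finitely many possible
  reductions, and each of them misses a number that is at most 31 and coprime to 19 and 37.
\<close>

section \<open>Primes with prescribed real characters\<close>

text \<open>A local-global argument only reaches some form of a genus, so the construction yields an
  unspecified form of half-discriminant \<open>p * D'\<close> representing \<open>n\<close>, and a
  finite list of reduced forms replaces a genus computation. Where the list has several classes, the
  others are carried to the target by rational isometries with denominator 2. The half-discriminant
  aimed at need not be that of the target: two of the forms for \<open>p = 5\<close> have
  half-discriminant 20 and one has 40, and these are reached from 5 and 10. For
  \<open>D' = 1\<close> the half-discriminant alone suffices, but for 10, 15 and 21 there are also
  reduced forms isotropic at \<open>p\<close>; anisotropy is tracked to discard them. It comes from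
  making \<open>-q\<close> a nonresidue modulo \<open>p\<close>, and the signs fit: for
  \<open>q\<close> congruent to 7 modulo 8 and \<open>(n D'/q) = 1\<close>, the condition
  \<open>(-n D/q) = 1\<close> requires \<open>(p/q) = -1\<close>, which reciprocity turns into
  \<open>(-q/p) = -1\<close>. Since \<open>q\<close> only has to exist, a product of factors
  \<open>1 \<plusminus> ch\<close> is summed against the Mangoldt function, and its expansion
  involves real characters only.\<close>

lemma abel_bound:
  fixes a g :: "nat \<Rightarrow> real"
  assumes part: "\<And>j. \<bar>\<Sum>n=M..<j. a n\<bar> \<le> B"
    and nonneg: "\<And>n. M \<le> n \<Longrightarrow> 0 \<le> g n"
    and dec: "\<And>n. M \<le> n \<Longrightarrow> g (Suc n) \<le> g n"
  shows "\<bar>\<Sum>n=M..<N. a n * g n\<bar> \<le> B * g M"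
proof (cases "M \<le> N")
  case True
  define S where "S j = (\<Sum>n=M..<j. a n)" for j
  have eq: "(\<Sum>n=M..<N. a n * g n) = S N * g N + (\<Sum>n=M..<N. S (Suc n) * (g n - g (Suc n)))"
    using True by (induction N rule: dec_induct) (auto simp: S_def algebra_simps)
  have tel: "(\<Sum>n=M..<N. g n - g (Suc n)) = g M - g N"
    using True sum_Suc_diff'[of M N "\<lambda>n. - g n"] by simp
  have SB: "\<bar>S j\<bar> \<le> B" for j using part by (simp add: S_def)
  have "\<bar>\<Sum>n=M..<N. a n * g n\<bar> \<le> \<bar>S N * g N\<bar> + (\<Sum>n=M..<N. \<bar>S (Suc n) * (g n - g (Suc n))\<bar>)"
    unfolding eq by (intro order_trans[OF abs_triangle_ineq] add_left_mono sum_abs)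
  also have "\<dots> \<le> B * g N + (\<Sum>n=M..<N. B * (g n - g (Suc n)))"
  proof (intro add_mono sum_mono)
    show "\<bar>S N * g N\<bar> \<le> B * g N"
      using SB nonneg[OF True] by (simp add: abs_mult mult_right_mono)
    show "\<bar>S (Suc n) * (g n - g (Suc n))\<bar> \<le> B * (g n - g (Suc n))" if "n \<in> {M..<N}" for n
      using SB dec[of n] that by (simp add: abs_mult mult_right_mono)
  qed
  also have "\<dots> = B * g M"
    unfolding sum_distrib_left[symmetric] tel by (simp add: algebra_simps)
  finally show ?thesis .
next
  case False
  have "0 \<le> B" using part[of M] by simp
  with False nonneg[of M] show ?thesis by simp
qed

lemma sum_geometric_from_1:
  fixes t :: real
  shows "(1 - t) * (\<Sum>m=1..M. t ^ m) = t - t ^ Suc M"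
proof (induction M)
  case (Suc M)
  have "(1 - t) * (\<Sum>m=1..Suc M. t ^ m) = (1 - t) * (\<Sum>m=1..M. t ^ m) + (1 - t) * t ^ Suc M"
    by (simp add: distrib_left)
  with Suc show ?case by (simp add: algebra_simps)
qed simp

text \<open>Pairs \<open>(n, d)\<close> with \<open>d\<close> dividing \<open>n\<close> correspond
  to pairs \<open>(d, m)\<close> with \<open>d * m \<le> N\<close>. The Lambert series, the
  factorial and the twisted logarithm sum below are all rearranged this way.\<close>

lemma sum_divisors_reorder:
  fixes g :: "nat \<Rightarrow> nat \<Rightarrow> real"
  shows "(\<Sum>n=1..N. \<Sum>d | d dvd n. g d (n div d)) = (\<Sum>d=1..N. \<Sum>m=1..N div d. g d m)"
proof -
  have le: "b \<le> N" if "0 < j" "b * j \<le> N" for b j :: nat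
    using order_trans[of b "b * j" N] that by simp
  have "(\<Sum>n=1..N. \<Sum>d | d dvd n. g d (n div d)) = (\<Sum>(n, d)\<in>(SIGMA n:{1..N}. {d. d dvd n}). g d (n div d))"
    by (subst sum.Sigma) auto
  also have "\<dots> = (\<Sum>(d, m)\<in>(SIGMA d:{1..N}. {1..N div d}). g d m)"
    by (rule sum.reindex_bij_witness[where i = "\<lambda>(d, m). (d * m, d)" and j = "\<lambda>(n, d). (d, n div d)"])
       (auto simp: less_eq_div_iff_mult_less_eq mult.commute Suc_le_eq elim!: dvdE intro: le)
  also have "\<dots> = (\<Sum>d=1..N. \<Sum>m=1..N div d. g d m)"
    by (subst sum.Sigma) auto
  finally show ?thesis .
qed

section \<open>Real characters and the value L(1)\<close>

locale real_character =
  fixes ch :: "nat \<Rightarrow> real" and k :: nat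
  assumes k_pos: "0 < k"
    and one: "ch 1 = 1"
    and mult: "ch (m * n) = ch m * ch n"
    and vals: "ch n \<in> {-1, 0, 1}"
    and periodic: "ch (n + k) = ch n"
    and nontrivial: "\<exists>u. coprime u k \<and> ch u = -1"
begin

lemma chi_abs: "\<bar>ch n\<bar> \<le> 1"
  using vals[of n] by auto

lemma periodic_mult: "ch (n + k * j) = ch n"
proof (induction j)
  case (Suc j)
  have "ch (n + k * Suc j) = ch ((n + k * j) + k)" by (simp add: algebra_simps)
  with Suc periodic show ?case by simp
qed auto

lemma chi_mod: "ch (n mod k) = ch n"
  using periodic_mult[of "n mod k" "n div k"] by simp

text \<open>Multiplication by a unit \<open>u\<close> with \<open>ch u = -1\<close> permutes the
  residues modulo \<open>k\<close> and reverses the sign of the sum.\<close>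

lemma sum_period: "(\<Sum>n<k. ch n) = 0"
proof -
  obtain u where u: "coprime u k" "ch u = -1" using nontrivial by auto
  have inj: "inj_on (\<lambda>n. (u * n) mod k) {..<k}"
  proof (rule inj_onI)
    fix x y assume xy: "x \<in> {..<k}" "y \<in> {..<k}" "(u * x) mod k = (u * y) mod k"
    then have "[u * x = u * y] (mod k)" by (simp add: cong_def)
    then have "[x = y] (mod k)" using u(1) cong_mult_lcancel_nat by blast
    with xy show "x = y" by (simp add: cong_def)
  qed
  have bij: "bij_betw (\<lambda>n. (u * n) mod k) {..<k} {..<k}"
    unfolding bij_betw_def using inj k_pos by (intro conjI endo_inj_surj) auto
  have "(\<Sum>n<k. ch n) = (\<Sum>n<k. ch ((u * n) mod k))"
    using sum.reindex_bij_betw[OF bij, of ch] by simp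
  also have "\<dots> = - (\<Sum>n<k. ch n)"
    by (simp add: chi_mod mult u sum_negf)
  finally show ?thesis by simp
qed

lemma sum_upto_bound: "\<bar>\<Sum>n<N. ch n\<bar> \<le> k"
proof -
  have per: "(\<Sum>n<r + k * j. ch n) = (\<Sum>n<r. ch n)" for r j
  proof (induction j)
    case (Suc j)
    have "(\<Sum>n<r + k * Suc j. ch n) = (\<Sum>n<(r + k * j) + k. ch n)" by (simp add: algebra_simps)
    also have "\<dots> = (\<Sum>n<k. ch n) + (\<Sum>n=k..<(r + k * j) + k. ch n)"
      by (simp add: lessThan_atLeast0 sum.atLeastLessThan_concat)
    also have "(\<Sum>n=k..<(r + k * j) + k. ch n) = (\<Sum>n<r + k * j. ch (n + k))"
      using sum.shift_bounds_nat_ivl[of ch 0 k "r + k * j"] by (simp add: lessThan_atLeast0)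
    finally show ?case using Suc by (simp add: sum_period periodic)
  qed auto
  have "\<bar>\<Sum>n<N. ch n\<bar> = \<bar>\<Sum>n<N mod k. ch n\<bar>" using per[of "N mod k" "N div k"] by simp
  also have "\<dots> \<le> (\<Sum>n<N mod k. 1)" by (intro order_trans[OF sum_abs] sum_mono chi_abs)
  also have "\<dots> \<le> k" using k_pos by (simp add: less_imp_le)
  finally show ?thesis .
qed

lemma sum_interval_bound: "\<bar>\<Sum>n=M..<N. ch n\<bar> \<le> 2 * k"
proof (cases "M \<le> N")
  case True
  then have "(\<Sum>n=M..<N. ch n) = (\<Sum>n<N. ch n) - (\<Sum>n<M. ch n)"
    using sum_diff_nat_ivl[of 0 M N ch] by (simp add: lessThan_atLeast0)
  then show ?thesis using sum_upto_bound[of N] sum_upto_bound[of M] by linarith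
qed auto

lemma weighted_bound:
  fixes g :: "nat \<Rightarrow> real"
  assumes "\<And>n. M \<le> n \<Longrightarrow> 0 \<le> g n" "\<And>n. M \<le> n \<Longrightarrow> g (Suc n) \<le> g n"
  shows "\<bar>\<Sum>n=M..<N. ch n * g n\<bar> \<le> 2 * k * g M"
  by (rule abel_bound) (use sum_interval_bound assms in auto)

text \<open>This is L(1, ch): the term at \<open>n = 0\<close> vanishes because division by zero
  gives 0.\<close>

definition L :: real where "L = (\<Sum>n. ch n / n)"

lemma L_tail: "\<bar>L - (\<Sum>n\<in>{1..N}. ch n / n)\<bar> \<le> 2 * k / Suc N"
proof -
  have b: "\<bar>\<Sum>n=M..<N. ch n / n\<bar> \<le> 2 * k / M" if "0 < M" for M N
    using weighted_bound[of M "\<lambda>n. 1 / n" N] that by (simp add: frac_le)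
  have "summable (\<lambda>n. ch n / n)"
    unfolding summable_Cauchy
  proof (intro allI impI)
    fix e :: real assume e: "0 < e"
    obtain M where M: "2 * k / e < real M" using reals_Archimedean2 by blast
    have "0 < 2 * k / e" using e k_pos by simp
    with M have M0: "0 < M" using of_nat_0_less_iff[where 'a = real] by linarith
    show "\<exists>M. \<forall>m\<ge>M. \<forall>n. norm (\<Sum>n=m..<n. ch n / n) < e"
    proof (intro exI allI impI)
      fix m n assume mn: "M \<le> m"
      have "norm (\<Sum>n=m..<n. ch n / n) \<le> 2 * k / m" using b[of m n] mn M0 by simp
      also have "\<dots> \<le> 2 * k / M" using mn M0 by (intro divide_left_mono) auto
      also have "\<dots> < e" using M e M0 by (simp add: field_simps)
      finally show "norm (\<Sum>n=m..<n. ch n / n) < e" .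
    qed
  qed
  then have lim: "(\<lambda>j. (\<Sum>n<j. ch n / n)) \<longlonglongrightarrow> L"
    unfolding L_def by (rule summable_LIMSEQ)
  have "(\<lambda>j. \<bar>(\<Sum>n<j. ch n / n) - (\<Sum>n\<in>{1..N}. ch n / n)\<bar>) \<longlonglongrightarrow> \<bar>L - (\<Sum>n\<in>{1..N}. ch n / n)\<bar>"
    by (intro tendsto_intros lim)
  moreover have "\<bar>(\<Sum>n<j. ch n / n) - (\<Sum>n\<in>{1..N}. ch n / n)\<bar> \<le> 2 * k / Suc N" if "Suc N \<le> j" for j
  proof -
    have "(\<Sum>n\<in>{1..N}. ch n / n) = (\<Sum>n<Suc N. ch n / n)"
      by (intro sum.mono_neutral_left) auto
    then have "(\<Sum>n<j. ch n / n) - (\<Sum>n\<in>{1..N}. ch n / n) = (\<Sum>n=Suc N..<j. ch n / n)"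
      using sum_diff_nat_ivl[of 0 "Suc N" j "\<lambda>n. ch n / n"] that by (simp add: lessThan_atLeast0)
    then show ?thesis using b[of "Suc N" j] by simp
  qed
  ultimately show ?thesis by (intro LIMSEQ_le_const2) auto
qed

text \<open>The convolution of \<open>ch\<close> with the constant 1, which gives the power series
  coefficients of the Lambert series \<open>\<Sum> ch n t^n / (1 - t^n)\<close>.\<close>

definition F :: "nat \<Rightarrow> real" where "F n = (\<Sum>d | d dvd n. ch d)"

lemma F_prime_power_mult:
  assumes "prime p" "\<not> p dvd m" "0 < m"
  shows "F (p ^ a * m) = (\<Sum>i\<le>a. ch p ^ i) * F m"
proof -
  have pw: "ch (p ^ i) = ch p ^ i" for i by (induction i) (use one mult in auto)
  have inj: "inj_on (\<lambda>(i, d). p ^ i * d) ({..a} \<times> {d. d dvd m})"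
  proof (rule inj_onI, clarsimp)
    fix i d j e assume h: "d dvd m" "e dvd m" "p ^ i * d = p ^ j * e"
    have nd: "\<not> p dvd d" "\<not> p dvd e" using h assms dvd_trans by blast+
    have mi: "multiplicity p (p ^ i * d) = i" if "\<not> p dvd d" for i d
    proof -
      have "0 < d" using that by (intro Nat.gr0I) auto
      then show ?thesis using assms(1) that
        by (subst prime_elem_multiplicity_mult_distrib)
           (auto simp: not_dvd_imp_multiplicity_0 multiplicity_same_power prime_gt_0_nat gr0_conv_Suc)
    qed
    have "i = j" using mi[of d i] mi[of e j] nd h(3) by simp
    with h(3) assms(1) show "i = j \<and> d = e" by (auto simp: prime_gt_0_nat)
  qed
  have im: "(\<lambda>(i, d). p ^ i * d) ` ({..a} \<times> {d. d dvd m}) = {d. d dvd p ^ a * m}"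
  proof (intro equalityI subsetI)
    fix x assume "x \<in> {d. d dvd p ^ a * m}"
    then obtain u v where uv: "x = u * v" "u dvd p ^ a" "v dvd m"
      using division_decomp by blast
    then obtain i where "i \<le> a" "u = p ^ i" using assms(1) divides_primepow_nat by blast
    with uv show "x \<in> (\<lambda>(i, d). p ^ i * d) ` ({..a} \<times> {d. d dvd m})" by auto
  qed (auto intro!: mult_dvd_mono le_imp_power_dvd)
  have "F (p ^ a * m) = (\<Sum>(i, d)\<in>{..a} \<times> {d. d dvd m}. ch (p ^ i * d))"
    unfolding F_def im[symmetric] by (subst sum.reindex[OF inj]) (auto simp: case_prod_unfold)
  also have "\<dots> = (\<Sum>i\<le>a. \<Sum>d | d dvd m. ch p ^ i * ch d)"
    using assms(3) by (subst sum.Sigma) (auto simp: mult pw)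
  also have "\<dots> = (\<Sum>i\<le>a. ch p ^ i) * F m"
    by (simp add: F_def sum_product)
  finally show ?thesis .
qed

lemma geometric_sign: "0 \<le> (\<Sum>i\<le>a. ch p ^ i)" "even a \<Longrightarrow> 1 \<le> (\<Sum>i\<le>a. ch p ^ i)"
proof -
  have "(\<Sum>i\<le>a. (-1::real) ^ i) = (if even a then 1 else 0)" by (induction a) auto
  moreover have "(\<Sum>i\<le>a. (0::real) ^ i) = 1" by (induction a) auto
  ultimately show "0 \<le> (\<Sum>i\<le>a. ch p ^ i)" "even a \<Longrightarrow> 1 \<le> (\<Sum>i\<le>a. ch p ^ i)"
    using vals[of p] by auto
qed

lemma split_prime_power:
  assumes "1 < (n::nat)"
  obtains p a m where "prime p" "0 < a" "n = p ^ a * m" "\<not> p dvd m" "0 < m" "m < n"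
proof -
  obtain p where p: "prime p" "p dvd n" using assms prime_factor_nat[of n] by auto
  define a where "a = multiplicity p n"
  obtain m where m: "n = p ^ a * m" "\<not> p dvd m"
    using multiplicity_decompose'[of n p] assms p a_def by (metis not_prime_unit not_one_less_zero)
  have "0 < a" using p assms by (simp add: a_def prime_multiplicity_gt_zero_iff)
  moreover have "0 < m" using m assms by (intro Nat.gr0I) auto
  moreover have "m < n"
    using m(1) \<open>0 < m\<close> \<open>0 < a\<close> one_less_power[OF prime_gt_1_nat[OF p(1)]] by simp
  ultimately show ?thesis using that p m by blast
qed

lemma F_nonneg: "0 < n \<Longrightarrow> 0 \<le> F n"
proof (induction n rule: less_induct)
  case (less n)
  show ?case
  proof (cases "n = 1")
    case False
    with less.prems have "1 < n" by simp
    then obtain p a m where *: "prime p" "n = p ^ a * m" "\<not> p dvd m" "0 < m" "m < n"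
      by (rule split_prime_power)
    then show ?thesis using less.IH[of m] geometric_sign(1) F_prime_power_mult[of p m a] by simp
  qed (use one in \<open>simp add: F_def\<close>)
qed

lemma F_square: "0 < n \<Longrightarrow> 1 \<le> F (n ^ 2)"
proof (induction n rule: less_induct)
  case (less n)
  show ?case
  proof (cases "n = 1")
    case False
    with less.prems have "1 < n" by simp
    then obtain p a m where *: "prime p" "n = p ^ a * m" "\<not> p dvd m" "0 < m" "m < n"
      by (rule split_prime_power)
    have "F (n ^ 2) = F (p ^ (2 * a) * m ^ 2)"
      using * by (simp add: power_mult_distrib power_mult[symmetric] mult.commute)
    also have "\<dots> = (\<Sum>i\<le>2 * a. ch p ^ i) * F (m ^ 2)"
      using * by (intro F_prime_power_mult) (auto simp: prime_dvd_power_iff)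
    finally show ?thesis
      using less.IH[of m] * geometric_sign(2)[of "2 * a" p]
        mult_mono[of 1 "\<Sum>i\<le>2 * a. ch p ^ i" 1 "F (m ^ 2)"] by auto
  qed (use one in \<open>simp add: F_def\<close>)
qed

end

section \<open>Nonvanishing of L(1) through a Lambert series\<close>

lemma geometric_sum_ge:
  fixes s :: real
  assumes "0 < s"
  shows "real n * s ^ (n - 1) \<le> (\<Sum>i<n. (s ^ 2) ^ i)"
proof -
  have "2 * (real n * s ^ (n - 1)) = (\<Sum>i<n. 2 * s ^ (n - 1))" by simp
  \<comment> \<open>The terms with exponents \<open>i\<close> and \<open>n - 1 - i\<close> are
    paired: their geometric mean is always \<open>s ^ (n - 1)\<close>.\<close>
  also have "\<dots> \<le> (\<Sum>i<n. (s ^ 2) ^ i + (s ^ 2) ^ (n - Suc i))"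
  proof (rule sum_mono)
    fix i assume "i \<in> {..<n}"
    then have "s ^ (n - 1) = s ^ i * s ^ (n - Suc i)" by (simp add: power_add[symmetric])
    moreover have "2 * (s ^ i * s ^ (n - Suc i)) \<le> (s ^ i) ^ 2 + (s ^ (n - Suc i)) ^ 2"
      using sum_squares_bound[of "s ^ i" "s ^ (n - Suc i)"] by simp
    ultimately show "2 * s ^ (n - 1) \<le> (s ^ 2) ^ i + (s ^ 2) ^ (n - Suc i)"
      by (simp add: power_mult[symmetric] mult.commute)
  qed
  also have "\<dots> = 2 * (\<Sum>i<n. (s ^ 2) ^ i)"
    using sum.nat_diff_reindex[of "\<lambda>i. (s ^ 2) ^ i" n] by (simp add: sum.distrib)
  finally show ?thesis by simp
qed

text \<open>The error made when \<open>t^n / (1 - t^n)\<close> is replaced by its polar part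
  \<open>1 / (n (1 - t))\<close> at \<open>t = 1\<close>. With the polar parts, the Lambert series
  of \<open>ch\<close> becomes \<open>L / (1 - t)\<close>; the gaps decrease in \<open>n\<close>, so
  summation by parts bounds their contribution uniformly in \<open>t\<close>.\<close>

definition lambert_gap :: "real \<Rightarrow> nat \<Rightarrow> real" where
  "lambert_gap t n = 1 / (real n * (1 - t)) - t ^ n / (1 - t ^ n)"

text \<open>After multiplication by \<open>1 - t\<close>, with
  \<open>G n = 1 + t + ... + t^(n-1)\<close>, monotonicity reads
  \<open>t^n / (G n * G (n + 1)) \<le> 1 / (n (n + 1))\<close>. It follows from
  \<open>G m \<ge> m s^(m-1)\<close> for \<open>s = sqrt t\<close>, because
  \<open>s^(2n-1) \<ge> s^(2n) = t^n\<close>.\<close>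

lemma lambert_gap_props:
  assumes t: "0 < t" "t < 1" and n: "1 \<le> n"
  shows "0 \<le> lambert_gap t n" and "lambert_gap t (Suc n) \<le> lambert_gap t n"
proof -
  define G where "G m = (\<Sum>i<m. t ^ i)" for m
  have G: "1 - t ^ m = (1 - t) * G m" for m
    using one_diff_power_eq[of t m] by (simp add: G_def)
  have Gpos: "0 < G m" if "1 \<le> m" for m
    unfolding G_def using t that by (intro sum_pos) (auto simp: lessThan_empty_iff)
  have eq: "lambert_gap t m = (1 / real m - t ^ m / G m) / (1 - t)" if "1 \<le> m" for m
    unfolding lambert_gap_def G by (simp add: diff_divide_distrib mult.commute)
  have "real n * t ^ n = (\<Sum>i<n. t ^ n)" by simp
  also have "\<dots> \<le> G n"
    unfolding G_def using t by (intro sum_mono power_decreasing) auto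
  finally show "0 \<le> lambert_gap t n"
    unfolding eq[OF n] using t n Gpos[OF n] by (intro divide_nonneg_nonneg) (auto simp: field_simps)
  define s where "s = sqrt t"
  have s: "0 < s" "s ^ 2 = t" "s \<le> 1" using t by (auto simp: s_def)
  have g: "real m * s ^ (m - 1) \<le> G m" for m
    using geometric_sum_ge[OF s(1), of m] by (simp add: G_def s(2))
  have "real n * real (Suc n) * t ^ n \<le> real n * real (Suc n) * (s ^ (n - 1) * s ^ n)"
  proof -
    have "t ^ n = s ^ (2 * n)" using s by (simp add: power_mult)
    also have "\<dots> \<le> s ^ (n - 1 + n)" using s by (intro power_decreasing) auto
    finally show ?thesis by (intro mult_left_mono) (auto simp: power_add)
  qed
  also have "\<dots> = (real n * s ^ (n - 1)) * (real (Suc n) * s ^ (Suc n - 1))" by simp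
  also have "\<dots> \<le> G n * G (Suc n)"
    using g[of n] g[of "Suc n"] Gpos[OF n] s by (intro mult_mono) auto
  finally have key: "t ^ n / (G n * G (Suc n)) \<le> 1 / (real n * real (Suc n))"
    using n Gpos[of n] Gpos[of "Suc n"] by (simp add: pos_divide_le_eq pos_le_divide_eq mult.commute)
  have "t ^ n / G n - t ^ Suc n / G (Suc n) = t ^ n * (G (Suc n) - t * G n) / (G n * G (Suc n))"
    using Gpos[of n] Gpos[of "Suc n"] n by (simp add: field_simps)
  also have "G (Suc n) - t * G n = 1"
  proof -
    have "(1 - t) * (G (Suc n) - t * G n) = (1 - t ^ Suc n) - t * (1 - t ^ n)"
      unfolding G by (simp add: algebra_simps)
    also have "\<dots> = (1 - t) * 1" by (simp add: algebra_simps)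
    finally show ?thesis using t by simp
  qed
  finally have "t ^ n / G n - t ^ Suc n / G (Suc n) \<le> 1 / (real n * real (Suc n))"
    using key by simp
  also have "\<dots> = 1 / real n - 1 / real (Suc n)" using n by (simp add: field_simps)
  finally show "lambert_gap t (Suc n) \<le> lambert_gap t n"
    unfolding eq[OF n] eq[OF le_SucI[OF n]] using t by (intro divide_right_mono) auto
qed

context real_character
begin

text \<open>The summand \<open>2 * k\<close> bounds the gaps, the first of which equals 1. The
  second summand is the tail of \<open>L = 0\<close> beyond \<open>N\<close>, and the third collects
  the remainders of \<open>N\<close> truncated geometric series.\<close>

lemma F_lambert_bound:
  assumes t: "0 < t" "t < 1" and L0: "L = 0"
  shows "(\<Sum>n=1..N. F n * t ^ n) \<le> 2 * k + (2 * k / Suc N) / (1 - t) + real N * t ^ N / (1 - t)"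
proof -
  have tpow: "t ^ d \<le> t" if "1 \<le> d" for d
    using power_decreasing[of 1 d t] t that by simp
  have "(\<Sum>n=1..N. F n * t ^ n) = (\<Sum>n=1..N. \<Sum>d | d dvd n. ch d * (t ^ d) ^ (n div d))"
    by (intro sum.cong) (auto simp: F_def sum_distrib_right power_mult[symmetric])
  also have "\<dots> = (\<Sum>d=1..N. ch d * (\<Sum>m=1..N div d. (t ^ d) ^ m))"
    by (subst sum_divisors_reorder) (simp add: sum_distrib_left)
  also have "\<dots> \<le> (\<Sum>d=1..N. ch d * (t ^ d / (1 - t ^ d)) + t ^ N / (1 - t))"
  proof (rule sum_mono)
    fix d assume d: "d \<in> {1..N}"
    have lt: "t ^ d < 1" using tpow[of d] t d by auto
    define e where "e = (t ^ d) ^ Suc (N div d) / (1 - t ^ d)"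
    have sm: "(\<Sum>m=1..N div d. (t ^ d) ^ m) = t ^ d / (1 - t ^ d) - e"
      using sum_geometric_from_1[of "t ^ d" "N div d"] lt
      by (simp add: e_def diff_divide_distrib[symmetric] eq_divide_eq mult.commute)
    have "N \<le> d * Suc (N div d)"
      using d dividend_less_times_div[of d N] by simp
    then have "(t ^ d) ^ Suc (N div d) \<le> t ^ N"
      unfolding power_mult[symmetric] using t by (intro power_decreasing) auto
    then have "e \<le> t ^ N / (1 - t)"
      unfolding e_def using t tpow[of d] d by (intro frac_le) auto
    moreover have "0 \<le> e" unfolding e_def using t lt by (intro divide_nonneg_nonneg) auto
    moreover have "\<bar>ch d * e\<bar> \<le> 1 * \<bar>e\<bar>"
      unfolding abs_mult by (intro mult_right_mono chi_abs) auto
    ultimately show "ch d * (\<Sum>m=1..N div d. (t ^ d) ^ m) \<le> ch d * (t ^ d / (1 - t ^ d)) + t ^ N / (1 - t)"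
      unfolding sm right_diff_distrib by linarith
  qed
  also have "\<dots> = (\<Sum>d=1..N. ch d * (t ^ d / (1 - t ^ d))) + real N * t ^ N / (1 - t)"
    by (simp add: sum.distrib)
  also have "(\<Sum>d=1..N. ch d * (t ^ d / (1 - t ^ d)))
      = (\<Sum>d=1..N. ch d / d) / (1 - t) - (\<Sum>d=1..<Suc N. ch d * lambert_gap t d)"
    unfolding sum_divide_distrib atLeastLessThanSuc_atLeastAtMost sum_subtractf[symmetric]
    by (intro sum.cong) (auto simp: lambert_gap_def right_diff_distrib)
  also have "\<dots> \<le> 2 * k + (2 * k / Suc N) / (1 - t)"
  proof -
    have "\<bar>\<Sum>d=1..<Suc N. ch d * lambert_gap t d\<bar> \<le> 2 * k * lambert_gap t 1"
      using lambert_gap_props[OF t] by (intro weighted_bound) auto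
    also have "lambert_gap t 1 = 1" using t by (simp add: lambert_gap_def field_simps)
    finally have "\<bar>\<Sum>d=1..<Suc N. ch d * lambert_gap t d\<bar> \<le> 2 * k" by simp
    moreover have "(\<Sum>d=1..N. ch d / d) / (1 - t) \<le> (2 * k / Suc N) / (1 - t)"
      using L_tail[of N] L0 t by (intro divide_right_mono) auto
    ultimately show ?thesis by linarith
  qed
  finally show ?thesis by simp
qed

text \<open>As \<open>F\<close> is nonnegative, all non-squares may be dropped; each of the
  \<open>M\<close> remaining squares contributes at least \<open>t ^ (M ^ 2)\<close>.\<close>

lemma F_lambert_lower:
  assumes t: "0 < t" "t < 1" and N: "M ^ 2 \<le> N"
  shows "real M * t ^ (M ^ 2) \<le> (\<Sum>n=1..N. F n * t ^ n)"
proof -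
  have "real M * t ^ (M ^ 2) = (\<Sum>m=1..M. t ^ (M ^ 2))" by simp
  also have "\<dots> \<le> (\<Sum>m=1..M. F (m ^ 2) * t ^ (m ^ 2))"
  proof (rule sum_mono)
    fix m assume m: "m \<in> {1..M}"
    have "t ^ (M ^ 2) \<le> 1 * t ^ (m ^ 2)" using t m by (simp add: power_decreasing power_mono)
    also have "\<dots> \<le> F (m ^ 2) * t ^ (m ^ 2)"
      using F_square[of m] t m by (intro mult_right_mono) auto
    finally show "t ^ (M ^ 2) \<le> F (m ^ 2) * t ^ (m ^ 2)" .
  qed
  also have "\<dots> = (\<Sum>n\<in>(\<lambda>m. m ^ 2) ` {1..M}. F n * t ^ n)"
    by (subst sum.reindex) (auto simp: inj_on_def)
  also have "\<dots> \<le> (\<Sum>n=1..N. F n * t ^ n)"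
  proof (rule sum_mono2)
    show "(\<lambda>m. m ^ 2) ` {1..M} \<subseteq> {1..N}"
      using N by (auto simp: Suc_le_eq intro: order_trans[OF power_mono])
    show "0 \<le> F n * t ^ n" if "n \<in> {1..N} - (\<lambda>m. m ^ 2) ` {1..M}" for n
      using that t F_nonneg[of n] by auto
  qed auto
  finally show ?thesis .
qed

text \<open>If \<open>L = 0\<close>, the Lambert series \<open>\<Sum> ch n t\<^sup>n / (1 - t\<^sup>n) = \<Sum> F n t\<^sup>n\<close> stays bounded as
  \<open>t\<close> tends to 1, although \<open>F \<ge> 1\<close> on the squares.\<close>

lemma L_nonzero: "L \<noteq> 0"
proof
  assume L0: "L = 0"
  define M where "M = 2 * k + 1"
  \<comment> \<open>The limits are taken in this order: \<open>N\<close> to infinity for fixed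
    \<open>t < 1\<close>, where the truncation errors vanish, and only then \<open>t\<close> to 1.
    What is left is \<open>M \<le> 2 * k\<close>, which the choice of \<open>M\<close>
    contradicts.\<close>
  have bound: "real M * t ^ (M ^ 2) \<le> 2 * k" if t: "0 < t" "t < 1" for t
  proof (rule tendsto_lowerbound)
    have "(\<lambda>N. 2 * k / Suc N) \<longlonglongrightarrow> 0"
      using LIMSEQ_Suc[OF lim_const_over_n[of "2 * real k"]] by simp
    moreover have "(\<lambda>N. real N * t ^ N) \<longlonglongrightarrow> 0"
      using powser_times_n_limit_0[of t] t by simp
    ultimately have "(\<lambda>N. 2 * k + (2 * k / Suc N) / (1 - t) + real N * t ^ N / (1 - t))
        \<longlonglongrightarrow> 2 * k + 0 / (1 - t) + 0 / (1 - t)"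
      using t by (intro tendsto_intros) auto
    then show "(\<lambda>N. 2 * k + (2 * k / Suc N) / (1 - t) + real N * t ^ N / (1 - t)) \<longlonglongrightarrow> 2 * k"
      by simp
    show "eventually (\<lambda>N. real M * t ^ (M ^ 2)
        \<le> 2 * k + (2 * k / Suc N) / (1 - t) + real N * t ^ N / (1 - t)) sequentially"
      using eventually_ge_at_top[of "M ^ 2"]
      by eventually_elim (use F_lambert_lower F_lambert_bound t L0 order_trans in blast)
  qed simp
  have "real M * 1 ^ (M ^ 2) \<le> 2 * k"
  proof (rule tendsto_upperbound)
    show "((\<lambda>t. real M * t ^ (M ^ 2)) \<longlongrightarrow> real M * 1 ^ (M ^ 2)) (at_left 1)"
      by (intro tendsto_intros)
    show "eventually (\<lambda>t. real M * t ^ (M ^ 2) \<le> 2 * k) (at_left (1::real))"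
      using eventually_at_left_real[OF zero_less_one] by eventually_elim (use bound in auto)
  qed simp
  then show False by (simp add: M_def)
qed

end

section \<open>Estimates of Chebyshev and Mertens\<close>

lemma ln_Suc_diff_le:
  assumes "0 < n" shows "ln (real (Suc n)) - ln (real n) \<le> 1 / n"
proof -
  have "ln (real (Suc n)) = ln (real n * (1 + 1 / n))" using assms by (simp add: distrib_left)
  also have "\<dots> = ln (real n) + ln (1 + 1 / n)"
    using assms by (intro ln_mult_pos) (auto intro: add_pos_pos)
  also have "ln (1 + 1 / real n) \<le> 1 / n" by (intro ln_add_one_self_le_self) auto
  finally show ?thesis by simp
qed

lemma ln_fact_mangoldt:
  "ln (fact N) = (\<Sum>d=1..N. (mangoldt d :: real) * real (N div d))"
proof -
  have "ln (fact N :: real) = (\<Sum>n=1..N. ln (real n))"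
    by (induction N) (auto simp: ln_mult simp flip: of_nat_Suc)
  also have "\<dots> = (\<Sum>n=1..N. \<Sum>d | d dvd n. (mangoldt d :: real))"
    by (intro sum.cong) (auto simp: mangoldt_sum[where 'a = real])
  also have "\<dots> = (\<Sum>d=1..N. (mangoldt d :: real) * real (N div d))"
    by (subst sum_divisors_reorder) (simp add: mult.commute)
  finally show ?thesis .
qed

definition psi :: "nat \<Rightarrow> real" where "psi N = (\<Sum>d=1..N. mangoldt d)"

lemma psi_mono: "M \<le> N \<Longrightarrow> psi M \<le> psi N"
  unfolding psi_def by (intro sum_mono2) (auto intro: mangoldt_nonneg)

text \<open>The logarithm of the central binomial coefficient is a sum of \<open>mangoldt d\<close>
  times floor(2m/d) - 2 floor(m/d). This factor is never negative and is at least 1 for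
  \<open>m < d \<le> 2 * m\<close>, while the coefficient itself is at most
  \<open>2 ^ (2 * m)\<close>.\<close>

lemma psi_double: "psi (2 * m) \<le> psi m + 2 * real m"
proof -
  have fct: "fact (2 * m) = (fact m * fact m * of_nat ((2 * m) choose m) :: real)"
  proof -
    have "fact m * fact (2 * m - m) * ((2 * m) choose m) = fact (2 * m)"
      by (rule binomial_fact_lemma) simp
    moreover have "2 * m - m = m" by simp
    ultimately have "fact (2 * m) = fact m * fact m * ((2 * m) choose m)" by simp
    then show ?thesis by (metis of_nat_fact of_nat_mult)
  qed
  have pos: "0 < (2 * m) choose m" by (simp add: zero_less_binomial)
  have "(2 * m) choose m \<le> 2 ^ (2 * m)" by (rule binomial_le_pow2)
  then have "real ((2 * m) choose m) \<le> real (2 ^ (2 * m))" by (rule of_nat_mono)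
  then have "real ((2 * m) choose m) \<le> 2 ^ (2 * m)" by simp
  then have "ln (real ((2 * m) choose m)) \<le> ln (2 ^ (2 * m))"
    using pos by (subst ln_le_cancel_iff) auto
  also have "\<dots> = 2 * real m * ln 2" by (simp add: ln_realpow)
  also have "\<dots> \<le> 2 * real m * 1" using ln_2_less_1 by (intro mult_left_mono) auto
  finally have up: "ln (real ((2 * m) choose m)) \<le> 2 * real m" by simp
  have "ln (real ((2 * m) choose m)) = ln (fact (2 * m)) - 2 * ln (fact m)"
    unfolding fct using pos by (simp add: ln_mult)
  also have "\<dots> = (\<Sum>d=1..2 * m. mangoldt d * (real (2 * m div d) - 2 * real (m div d)))"
  proof -
    have "(\<Sum>d=1..m. (mangoldt d :: real) * real (m div d)) = (\<Sum>d=1..2 * m. mangoldt d * real (m div d))"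
      by (intro sum.mono_neutral_left) auto
    then show ?thesis
      by (simp add: ln_fact_mangoldt right_diff_distrib sum_subtractf sum_distrib_left mult.left_commute)
  qed
  also have "\<dots> \<ge> (\<Sum>d=1..2 * m. if m < d then mangoldt d else 0)"
  proof (rule sum_mono)
    fix d assume d: "d \<in> {1..2 * m}"
    have "2 * (m div d) \<le> 2 * m div d"
      using d div_times_less_eq_dividend[of m d] by (simp add: less_eq_div_iff_mult_less_eq)
    then have "2 * real (m div d) \<le> real (2 * m div d)" 
      using of_nat_mono[where 'a = real] by fastforce
    moreover have "1 \<le> 2 * m div d" if "m < d" using d by (simp add: Suc_le_eq div_greater_zero_iff)
    ultimately show "(if m < d then mangoldt d else 0) \<le> mangoldt d * (real (2 * m div d) - 2 * real (m div d))"
      using mangoldt_nonneg[of d] by (auto simp: mult_le_cancel_left1 intro!: mult_nonneg_nonneg)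
  qed
  also have "(\<Sum>d=1..2 * m. if m < d then mangoldt d else 0) = psi (2 * m) - psi m"
  proof -
    have "{1..2 * m} = {1..m} \<union> {m<..2 * m}" by auto
    then have "psi (2 * m) = psi m + (\<Sum>d\<in>{m<..2 * m}. mangoldt d)"
      unfolding psi_def by (simp add: sum.union_disjoint ivl_disj_int)
    moreover have "(\<Sum>d=1..2 * m. if m < d then mangoldt d else (0::real)) = (\<Sum>d\<in>{m<..2 * m}. mangoldt d)"
      by (subst sum.inter_filter[symmetric]) (auto intro!: sum.cong)
    ultimately show ?thesis by simp
  qed
  finally show ?thesis using up by linarith
qed

lemma psi_le: "psi N \<le> 4 * real N"
proof (induction N rule: less_induct)
  case (less N)
  show ?case
  proof (cases "N < 3")
    case True
    then consider "N = 0" | "N = 1" | "N = 2" by linarith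
    then show ?thesis using psi_double[of 1] by cases (auto simp: psi_def)
  next
    case False
    \<comment> \<open>Halving upwards gives \<open>psi N \<le> 6 * m \<le> 3 * (N + 1)\<close>,
      which is at most \<open>4 * N\<close> exactly from \<open>N = 3\<close> on; hence the separate
      small cases.\<close>
    define m where "m = (N + 1) div 2"
    have m: "m < N" "N \<le> 2 * m" "2 * m \<le> N + 1" using False unfolding m_def by linarith+
    have "psi N \<le> psi m + 2 * real m" using psi_mono[OF m(2)] psi_double[of m] by linarith
    also have "\<dots> \<le> 6 * real m" using less.IH[OF m(1)] by simp
    finally show ?thesis using m(3) False by linarith
  qed
qed

lemma ln_fact_lower: "real N * ln N - real N \<le> ln (fact N)"
proof (induction N)
  case (Suc N)
  show ?case
  proof (cases "N = 0")
    case False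
    have "ln (real (Suc N)) - ln N \<le> 1 / N" using False by (intro ln_Suc_diff_le) auto
    then have "real N * (ln (real (Suc N)) - ln N) \<le> 1" using False by (simp add: field_simps)
    moreover have "ln (fact (Suc N) :: real) = ln (real (Suc N)) + ln (fact N)"
      by (simp add: ln_mult del: of_nat_Suc)
    ultimately show ?thesis using Suc by (simp add: algebra_simps)
  qed simp
qed simp

lemma mertens_lower:
  assumes "0 < N" shows "ln N - 1 \<le> (\<Sum>n=1..N. mangoldt n / real n)"
proof -
  have "real N * (ln N - 1) \<le> ln (fact N)" using ln_fact_lower[of N] by (simp add: algebra_simps)
  also have "\<dots> \<le> (\<Sum>d=1..N. mangoldt d * (real N / real d))"
    unfolding ln_fact_mangoldt
    by (intro sum_mono mult_left_mono mangoldt_nonneg of_nat_div_le_of_nat)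
  also have "\<dots> = real N * (\<Sum>n=1..N. mangoldt n / real n)"
    by (simp add: sum_distrib_left mult.commute)
  finally show ?thesis using assms by simp
qed

section \<open>The Mangoldt function twisted by a real character\<close>

context real_character
begin

lemma char_ln_bounded: "\<bar>\<Sum>n=1..N. ch n * (ln n / n)\<bar> \<le> 1 + 2 * k"
proof -
  define g where "g n = ln (real n) / real n" for n :: nat
  have g_small: "0 \<le> g n" "g n \<le> 1" if "1 \<le> n" for n
    using that ln_le_minus_one[of "real n"] by (auto simp: g_def field_simps)
  have g_dec: "g (Suc n) \<le> g n" if "3 \<le> n" for n
  proof -
    have "exp 1 \<le> real n" using that exp_le by (intro order_trans[OF exp_le]) auto
    then have 1: "1 \<le> ln (real n)" using that by (subst ln_ge_iff) auto
    have "ln (real (Suc n)) - ln n \<le> 1 / n" using that by (intro ln_Suc_diff_le) auto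
    then have "real n * (ln (real (Suc n)) - ln n) \<le> 1" using that by (simp add: field_simps)
    with 1 have "real n * ln (real (Suc n)) \<le> real (Suc n) * ln n" by (simp add: algebra_simps)
    then show ?thesis using that by (simp add: g_def field_simps)
  qed
  \<comment> \<open>\<open>ln n / n\<close> decreases only from \<open>n = 3\<close> on, so the
    terms for 1 and 2 are estimated by hand.\<close>
  have split: "{1..N} = ({1..N} \<inter> {1, 2}) \<union> {3..<Suc N}" by auto
  have "(\<Sum>n=1..N. ch n * g n) = (\<Sum>n\<in>{1..N} \<inter> {1, 2}. ch n * g n) + (\<Sum>n=3..<Suc N. ch n * g n)"
    by (subst split, rule sum.union_disjoint) auto
  moreover have "\<bar>\<Sum>n=3..<Suc N. ch n * g n\<bar> \<le> 2 * real k * g 3"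
    using weighted_bound[of 3 g "Suc N"] g_small g_dec by simp
  moreover have "2 * real k * g 3 \<le> 2 * real k * 1" using g_small[of 3] by (intro mult_left_mono) auto
  moreover have "\<bar>\<Sum>n\<in>{1..N} \<inter> {1, 2}. ch n * g n\<bar> \<le> (\<Sum>n\<in>{1..N} \<inter> {1, 2}. g n)"
    using chi_abs g_small
    by (intro order_trans[OF sum_abs] sum_mono) (auto simp: abs_mult intro!: mult_left_le_one_le)
  moreover have "(\<Sum>n\<in>{1..N} \<inter> {1, 2}. g n) \<le> (\<Sum>n\<in>{1, 2}. g n)"
    using g_small by (intro sum_mono2) auto
  moreover have "(\<Sum>n\<in>{1, 2}. g n) \<le> 1" using g_small[of 2] by (simp add: g_def)
  ultimately show ?thesis unfolding g_def by linarith
qed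

text \<open>Writing \<open>ln\<close> as a divisor sum of \<open>mangoldt\<close> makes the bounded
  sum of \<open>ch n * ln n / n\<close> equal to the twisted Mangoldt sum with weights
  \<open>T (N div d)\<close>. Replacing each weight by \<open>L\<close> costs at most
  \<open>psi N * 2 * k / N\<close>, hence at most \<open>8 * k\<close> by the Chebyshev bound; the
  other \<open>1 + 2 * k\<close> bounds the logarithm sum.\<close>

lemma char_mangoldt_bounded:
  "\<bar>L\<bar> * \<bar>\<Sum>n=1..N. ch n * (mangoldt n / n)\<bar> \<le> 1 + 10 * k"
proof (cases "N = 0")
  case False
  define a where "a d = ch d * (mangoldt d / real d)" for d
  define T where "T M = (\<Sum>m=1..M. ch m / real m)" for M :: nat
  have "(\<Sum>n=1..N. ch n * (ln n / n)) = (\<Sum>n=1..N. \<Sum>d | d dvd n. a d * (ch (n div d) / real (n div d)))"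
  proof (intro sum.cong refl)
    fix n assume n: "n \<in> {1..N}"
    have "(\<Sum>d | d dvd n. a d * (ch (n div d) / real (n div d))) = (\<Sum>d | d dvd n. (ch n / n) * mangoldt d)"
    proof (intro sum.cong refl)
      fix d assume "d \<in> {d. d dvd n}"
      then obtain e where "n = d * e" by auto
      with n show "a d * (ch (n div d) / real (n div d)) = (ch n / n) * mangoldt d"
        by (auto simp: a_def mult)
    qed
    also have "\<dots> = ch n * (ln n / n)"
      unfolding sum_distrib_left[symmetric] using n by (simp add: mangoldt_sum[where 'a = real])
    finally show "ch n * (ln n / n) = (\<Sum>d | d dvd n. a d * (ch (n div d) / real (n div d)))" ..
  qed
  also have "\<dots> = (\<Sum>d=1..N. a d * T (N div d))"
    by (subst sum_divisors_reorder) (simp add: T_def sum_distrib_left)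
  finally have eq: "(\<Sum>n=1..N. ch n * (ln n / n)) = (\<Sum>d=1..N. a d * T (N div d))" .
  have "\<bar>(\<Sum>d=1..N. a d) * L - (\<Sum>d=1..N. a d * T (N div d))\<bar> = \<bar>\<Sum>d=1..N. a d * (L - T (N div d))\<bar>"
    by (simp add: sum_distrib_right right_diff_distrib sum_subtractf)
  also have "\<dots> \<le> (\<Sum>d=1..N. mangoldt d * (2 * k / N))"
  proof (intro order_trans[OF sum_abs] sum_mono)
    fix d assume d: "d \<in> {1..N}"
    have "\<bar>a d\<bar> \<le> mangoldt d / d"
      using mult_right_mono[OF chi_abs[of d], of "mangoldt d / d"] mangoldt_nonneg[of d]
      by (simp add: a_def abs_mult)
    moreover have "\<bar>L - T (N div d)\<bar> \<le> 2 * k / Suc (N div d)" unfolding T_def by (rule L_tail)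
    moreover have "2 * k / Suc (N div d) \<le> d * (2 * k / N)"
    proof -
      have "N \<le> d * Suc (N div d)" using d dividend_less_times_div[of d N] by simp
      then have "real N \<le> real d * real (Suc (N div d))" by (metis of_nat_le_iff of_nat_mult)
      then have "2 * real k * real N \<le> 2 * real k * (real d * real (Suc (N div d)))"
        by (intro mult_left_mono) auto
      then show ?thesis using False by (simp add: field_simps)
    qed
    ultimately have "\<bar>a d\<bar> * \<bar>L - T (N div d)\<bar> \<le> (mangoldt d / d) * (d * (2 * k / N))"
      by (intro mult_mono) (auto intro!: divide_nonneg_nonneg mangoldt_nonneg)
    then show "\<bar>a d * (L - T (N div d))\<bar> \<le> mangoldt d * (2 * k / N)"
      using d by (simp add: abs_mult)
  qed
  also have "\<dots> = psi N * (2 * k / N)" by (simp only: psi_def sum_distrib_right)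
  also have "\<dots> \<le> (4 * real N) * (2 * k / N)" by (intro mult_right_mono psi_le) auto
  also have "\<dots> = 8 * k" using False by simp
  finally have "\<bar>(\<Sum>d=1..N. a d) * L\<bar> \<le> \<bar>\<Sum>n=1..N. ch n * (ln n / n)\<bar> + 8 * k"
    unfolding eq by linarith
  then show ?thesis using char_ln_bounded[of N] by (simp add: a_def abs_mult mult.commute)
qed simp

end

text \<open>A prime power that is not prime is recorded by its base and exponent, both at least 2.
  The geometric series over the exponents leaves at most \<open>2 * ln p / p^2\<close>, and
  \<open>ln p \<le> 2 * sqrt p\<close> turns this into the summable majorant
  \<open>4 * p powr (-3/2)\<close>.\<close>

lemma prime_power_tail_bounded:
  "\<exists>C. \<forall>N. (\<Sum>n | n \<in> {1..N} \<and> \<not> prime n. mangoldt n / real n) \<le> C"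
proof -
  define h where "h = (\<lambda>(p, j). ln (real p) / real p ^ j)"
  define \<phi> where "\<phi> n = (aprimedivisor n, multiplicity (aprimedivisor n) n)" for n :: nat
  define c where "c n = 4 * real n powr (-3/2)" for n
  have "summable (\<lambda>n. real n powr (-3/2))" by (subst summable_real_powr_iff) auto
  then have sc: "summable c" unfolding c_def by (intro summable_mult)
  have "(\<Sum>n | n \<in> {1..N} \<and> \<not> prime n. mangoldt n / real n) \<le> suminf c" for N
  proof -
    define S where "S = {n \<in> {1..N}. \<not> prime n \<and> primepow n}"
    have dec: "n = aprimedivisor n ^ multiplicity (aprimedivisor n) n" "prime (aprimedivisor n)"
      "2 \<le> multiplicity (aprimedivisor n) n" "multiplicity (aprimedivisor n) n \<le> n" if "n \<in> S" for n
    proof -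
      have pp: "primepow n" and np: "\<not> prime n" using that by (auto simp: S_def)
      show 1: "n = aprimedivisor n ^ multiplicity (aprimedivisor n) n"
        using primepow_decompose[OF pp] by simp
      show 2: "prime (aprimedivisor n)" using primepow_gt_Suc_0[OF pp] by (intro aprimedivisor_nat) auto
      show "2 \<le> multiplicity (aprimedivisor n) n"
      proof (rule ccontr)
        assume "\<not> ?thesis"
        then consider "multiplicity (aprimedivisor n) n = 0" | "multiplicity (aprimedivisor n) n = 1" by linarith
        then show False using 1 2 np primepow_gt_Suc_0[OF pp] by cases auto
      qed
      show "multiplicity (aprimedivisor n) n \<le> n"
      proof -
        have "multiplicity (aprimedivisor n) n \<le> 2 ^ multiplicity (aprimedivisor n) n"
          using less_exp less_imp_le by blast
        also have "\<dots> \<le> aprimedivisor n ^ multiplicity (aprimedivisor n) n"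
          using prime_ge_2_nat[OF 2] by (intro power_mono) auto
        finally show ?thesis using 1 by simp
      qed
    qed
    have inj: "inj_on \<phi> S"
    proof (rule inj_onI)
      fix x y assume S: "x \<in> S" "y \<in> S" and xy: "\<phi> x = \<phi> y"
      have "x = fst (\<phi> x) ^ snd (\<phi> x)" "y = fst (\<phi> y) ^ snd (\<phi> y)"
        using dec(1)[OF S(1)] dec(1)[OF S(2)] unfolding \<phi>_def fst_conv snd_conv .
      with xy show "x = y" by simp
    qed
    have "(\<Sum>n | n \<in> {1..N} \<and> \<not> prime n. mangoldt n / real n) = (\<Sum>n\<in>S. mangoldt n / real n)"
      by (intro sum.mono_neutral_right) (auto simp: S_def mangoldt_def)
    also have "\<dots> = (\<Sum>n\<in>S. h (\<phi> n))"
    proof (intro sum.cong refl)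
      fix n assume n: "n \<in> S"
      then have "mangoldt n = ln (real (aprimedivisor n))" by (simp add: S_def mangoldt_def)
      moreover have "real n = real (aprimedivisor n) ^ multiplicity (aprimedivisor n) n"
        using dec(1)[OF n] of_nat_power[where 'a = real] by simp
      ultimately show "mangoldt n / real n = h (\<phi> n)" by (simp add: h_def \<phi>_def)
    qed
    also have "\<dots> = sum h (\<phi> ` S)" using sum.reindex[OF inj, of h] by simp
    also have "\<dots> \<le> sum h ({2..N} \<times> {2..N})"
    proof (rule sum_mono2)
      show "\<phi> ` S \<subseteq> {2..N} \<times> {2..N}"
      proof clarify
        fix a b n assume ab: "n \<in> S" "(a, b) = \<phi> n"
        have "n \<le> N" "1 < n" using ab by (auto simp: S_def dest: primepow_gt_Suc_0)
        then show "a \<in> {2..N} \<and> b \<in> {2..N}"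
          using dec(2,3,4)[OF ab(1)] prime_ge_2_nat aprimedivisor_le_nat[of n] ab(2) by (auto simp: \<phi>_def)
      qed
      show "0 \<le> h b" if "b \<in> {2..N} \<times> {2..N} - \<phi> ` S" for b using that by (auto simp: h_def)
    qed auto
    also have "\<dots> = (\<Sum>p=2..N. \<Sum>j=2..N. ln (real p) / real p ^ j)"
      by (simp add: h_def sum.cartesian_product)
    also have "\<dots> \<le> (\<Sum>p=2..N. c p)"
    proof (rule sum_mono)
      fix p assume "p \<in> {2..N}"
      then have p: "2 \<le> p" by simp
      define x where "x = 1 / real p"
      have x: "0 < x" "x \<le> 1 / 2" using p by (auto simp: x_def field_simps)
      have "(1 - x) * (\<Sum>j=2..N. x ^ j) \<le> x ^ 2"
      proof (cases "2 \<le> N")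
        case True
        have "(1 - x) * (\<Sum>j=2..N. x ^ j) = x ^ 2 - x ^ Suc N"
          using True
        proof (induction N rule: dec_induct)
          case (step N)
          then have "(1 - x) * (\<Sum>j=2..Suc N. x ^ j) = (1 - x) * (\<Sum>j=2..N. x ^ j) + (1 - x) * x ^ Suc N"
            by (simp add: distrib_left)
          with step.IH show ?case by (simp add: algebra_simps)
        qed (simp add: algebra_simps power2_eq_square power3_eq_cube)
        with x show ?thesis by simp
      qed (use x in auto)
      moreover have "(1 / 2) * (\<Sum>j=2..N. x ^ j) \<le> (1 - x) * (\<Sum>j=2..N. x ^ j)"
        using x by (intro mult_right_mono sum_nonneg) auto
      ultimately have sx: "(\<Sum>j=2..N. x ^ j) \<le> 2 * x ^ 2" by linarith
      have "ln (real p) = 2 * ln (sqrt p)" using p by (simp add: ln_sqrt)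
      also have "\<dots> \<le> 2 * sqrt p"
        using p ln_le_minus_one[of "sqrt p"] by simp
      finally have lp: "ln (real p) \<le> 2 * sqrt p" .
      have "(\<Sum>j=2..N. ln (real p) / real p ^ j) = ln (real p) * (\<Sum>j=2..N. x ^ j)"
        by (simp add: x_def sum_distrib_left power_one_over)
      also have "\<dots> \<le> (2 * sqrt p) * (2 * x ^ 2)"
        using lp sx x p by (intro mult_mono) (auto intro!: sum_nonneg)
      also have "\<dots> = 4 * (real p powr (1/2) * real p powr (-2))"
        using p by (simp add: x_def powr_half_sqrt powr_minus power_one_over field_simps)
      also have "\<dots> = c p" unfolding c_def powr_add[symmetric] by simp
      finally show "(\<Sum>j=2..N. ln (real p) / real p ^ j) \<le> c p" .
    qed
    also have "\<dots> \<le> suminf c" by (intro sum_le_suminf sc) (auto simp: c_def)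
    finally show ?thesis .
  qed
  then show ?thesis by blast
qed

text \<open>The weight \<open>W\<close> vanishes at every prime where some character has the
  forbidden value. Expanded over subsets of \<open>I\<close>, its Mangoldt sum grows like
  \<open>ln N\<close> through the empty subset, since all other subsets give nontrivial characters
  and bounded sums. If no suitable prime existed, only \<open>B\<close> and the proper prime powers
  would contribute, a bounded amount.\<close>

lemma ex_prime_real_characters:
  fixes c :: "nat \<Rightarrow> nat \<Rightarrow> real" and \<epsilon> :: "nat \<Rightarrow> real"
  assumes fin: "finite I" "finite B" and k: "0 < k"
    and one: "\<And>i. i \<in> I \<Longrightarrow> c i 1 = 1"
    and mult: "\<And>i m n. i \<in> I \<Longrightarrow> c i (m * n) = c i m * c i n"
    and vals: "\<And>i n. i \<in> I \<Longrightarrow> c i n \<in> {-1, 0, 1}"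
    and periodic: "\<And>i n. i \<in> I \<Longrightarrow> c i (n + k) = c i n"
    and indep: "\<And>i. i \<in> I \<Longrightarrow> \<exists>u. coprime u k \<and> c i u = -1 \<and> (\<forall>j\<in>I - {i}. c j u = 1)"
    and sign: "\<And>i. i \<in> I \<Longrightarrow> \<epsilon> i \<in> {-1, 1}"
  shows "\<exists>q. prime q \<and> q \<notin> B \<and> (\<forall>i\<in>I. c i q \<noteq> - \<epsilon> i)"
proof (rule ccontr)
  assume contra: "\<not> ?thesis"
  define cT where "cT T n = (\<Prod>i\<in>T. c i n)" for T n
  define S where "S T N = (\<Sum>n=1..N. cT T n * (mangoldt n / real n))" for T N
  define W where "W n = (\<Prod>i\<in>I. 1 + \<epsilon> i * c i n)" for n
  have real_char: "real_character (cT T) k" if T: "T \<subseteq> I" "T \<noteq> {}" for T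
  proof
    show "0 < k" by fact
    show "cT T 1 = 1" using one T by (auto simp: cT_def intro!: prod.neutral)
    show "cT T (m * n) = cT T m * cT T n" for m n
      using mult T by (auto simp: cT_def prod.distrib[symmetric] intro!: prod.cong)
    show "cT T n \<in> {-1, 0, 1}" for n
    proof -
      have "finite T" using T fin finite_subset by blast
      then show ?thesis using T(1) unfolding cT_def
      proof (induction T rule: finite_induct)
        case (insert i T)
        then show ?case using vals[of i n] by auto
      qed auto
    qed
    show "cT T (n + k) = cT T n" for n using periodic T by (auto simp: cT_def intro!: prod.cong)
    \<comment> \<open>Independence is used here: a unit that only the \<open>i\<close>-th character
      sends to -1 shows that a product containing that character is nontrivial.\<close>
    obtain i where i: "i \<in> T" using T by blast
    then obtain u where u: "coprime u k" "c i u = -1" "\<forall>j\<in>I - {i}. c j u = 1" using indep T by blast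
    have "cT T u = c i u * (\<Prod>j\<in>T - {i}. c j u)"
      unfolding cT_def using i T fin finite_subset by (intro prod.remove) auto
    also have "(\<Prod>j\<in>T - {i}. c j u) = 1" using u T by (intro prod.neutral) auto
    finally show "\<exists>u. coprime u k \<and> cT T u = -1" using u by auto
  qed
  have "\<exists>C. \<forall>N. \<bar>S T N\<bar> \<le> C" if T: "T \<subseteq> I" "T \<noteq> {}" for T
  proof -
    interpret real_character "cT T" k using real_char[OF T] .
    have "\<bar>S T N\<bar> \<le> (1 + 10 * k) / \<bar>L\<bar>" for N
      using char_mangoldt_bounded[of N] L_nonzero unfolding S_def by (simp add: field_simps)
    then show ?thesis by blast
  qed
  then obtain C where C: "\<And>T N. T \<subseteq> I \<Longrightarrow> T \<noteq> {} \<Longrightarrow> \<bar>S T N\<bar> \<le> C T" by metis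
  obtain C' where C': "\<And>N. (\<Sum>n | n \<in> {1..N} \<and> \<not> prime n. mangoldt n / real n) \<le> C'"
    using prime_power_tail_bounded by blast
  define K where "K = (2::real) ^ card I"
  have W_nonneg: "0 \<le> W n" and W_le: "W n \<le> K" for n
  proof -
    have b: "0 \<le> 1 + \<epsilon> i * c i n \<and> 1 + \<epsilon> i * c i n \<le> 2" if "i \<in> I" for i
      using vals[OF that, of n] sign[OF that] by auto
    show "0 \<le> W n" unfolding W_def using b by (intro prod_nonneg) auto
    have "W n \<le> (\<Prod>i\<in>I. 2)" unfolding W_def using b by (intro prod_mono) auto
    then show "W n \<le> K" by (simp add: K_def)
  qed
  have expand: "(\<Sum>n=1..N. W n * (mangoldt n / n)) = (\<Sum>T\<in>Pow I. (\<Prod>i\<in>T. \<epsilon> i) * S T N)" for N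
  proof -
    have "W n = (\<Sum>T\<in>Pow I. (\<Prod>i\<in>T. \<epsilon> i) * cT T n)" for n
      using prod_add[OF fin(1), of "\<lambda>i. \<epsilon> i * c i n" "\<lambda>_. 1"]
      by (simp add: W_def cT_def prod.distrib add.commute)
    then have "(\<Sum>n=1..N. W n * (mangoldt n / n))
        = (\<Sum>n=1..N. \<Sum>T\<in>Pow I. (\<Prod>i\<in>T. \<epsilon> i) * (cT T n * (mangoldt n / n)))"
      by (simp only: sum_distrib_right mult.assoc)
    also have "\<dots> = (\<Sum>T\<in>Pow I. (\<Prod>i\<in>T. \<epsilon> i) * S T N)"
      by (subst sum.swap) (simp add: S_def sum_distrib_left)
    finally show ?thesis .
  qed
  define D where "D = (\<Sum>T\<in>Pow I - {{}}. C T)"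
  have lower: "ln N - 1 - D \<le> (\<Sum>n=1..N. W n * (mangoldt n / n))" if "0 < N" for N
  proof -
    have "(\<Sum>T\<in>Pow I. (\<Prod>i\<in>T. \<epsilon> i) * S T N)
        = (\<Prod>i\<in>{}. \<epsilon> i) * S {} N + (\<Sum>T\<in>Pow I - {{}}. (\<Prod>i\<in>T. \<epsilon> i) * S T N)"
      using fin by (intro sum.remove) auto
    moreover have "\<bar>\<Sum>T\<in>Pow I - {{}}. (\<Prod>i\<in>T. \<epsilon> i) * S T N\<bar> \<le> D"
      unfolding D_def
    proof (intro order_trans[OF sum_abs] sum_mono)
      fix T assume T: "T \<in> Pow I - {{}}"
      have "\<bar>\<Prod>i\<in>T. \<epsilon> i\<bar> = 1"
        unfolding abs_prod using T sign by (intro prod.neutral) (auto dest!: sign)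
      then show "\<bar>(\<Prod>i\<in>T. \<epsilon> i) * S T N\<bar> \<le> C T" using C[of T N] T by (simp add: abs_mult)
    qed
    moreover have "ln N - 1 \<le> S {} N" using mertens_lower[OF that] by (simp add: S_def cT_def)
    ultimately show ?thesis unfolding expand by simp
  qed
  define E where "E = K * (\<Sum>n\<in>B. mangoldt n / n) + K * C'"
  have upper: "(\<Sum>n=1..N. W n * (mangoldt n / n)) \<le> E" for N
  proof -
    have nn: "0 \<le> mangoldt n / real n" for n by (intro divide_nonneg_nonneg mangoldt_nonneg) auto
    have "(\<Sum>n=1..N. W n * (mangoldt n / n))
        \<le> (\<Sum>n=1..N. (if n \<in> B then K * (mangoldt n / n) else 0) + (if \<not> prime n then K * (mangoldt n / n) else 0))"
    proof (rule sum_mono)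
      fix n
      have "0 \<le> K" by (simp add: K_def)
      show "W n * (mangoldt n / n) \<le> (if n \<in> B then K * (mangoldt n / n) else 0) + (if \<not> prime n then K * (mangoldt n / n) else 0)"
      proof (cases "n \<in> B \<or> \<not> prime n")
        case True
        then show ?thesis
          using mult_right_mono[OF W_le[of n] nn[of n]] mult_nonneg_nonneg[OF \<open>0 \<le> K\<close> nn[of n]] by auto
      next
        case False
        then obtain i where i: "i \<in> I" "c i n = - \<epsilon> i" using contra by blast
        then have "1 + \<epsilon> i * c i n = 0" using sign[OF i(1)] by auto
        then have "W n = 0" unfolding W_def using fin i(1) by (auto simp: prod_zero_iff)
        with False show ?thesis by simp
      qed
    qed
    also have "\<dots> = (\<Sum>n\<in>{1..N} \<inter> B. K * (mangoldt n / n)) + (\<Sum>n | n \<in> {1..N} \<and> \<not> prime n. K * (mangoldt n / n))"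
      unfolding sum.distrib
      by (subst sum.inter_restrict, simp, subst sum.inter_filter, simp, rule refl)
    also have "\<dots> \<le> E"
      unfolding E_def sum_distrib_left[symmetric]
      using C'[of N] nn fin by (intro add_mono mult_left_mono sum_mono2) (auto simp: K_def)
    finally show ?thesis .
  qed
  obtain N where N: "exp (E + D + 2) < real N" using reals_Archimedean2 by blast
  have "0 < real N" using N exp_gt_zero[of "E + D + 2"] by linarith
  then have "0 < N" by simp
  have "E + D + 2 < ln (real N)" using N \<open>0 < real N\<close> by (metis exp_less_cancel_iff exp_ln)
  with lower[OF \<open>0 < N\<close>] upper[of N] show False by linarith
qed

section \<open>Legendre symbols\<close>

lemma coprime_8_odd: "odd (a::nat) \<Longrightarrow> coprime 8 a"
proof -
  assume "odd a"
  then have "coprime (2 ^ 3) a" by (subst coprime_power_left_iff) simp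
  then show ?thesis by simp
qed

lemma Legendre_vals: "Legendre a p \<in> {-1, 0, 1}"
  by (auto simp: Legendre_def)

lemma Legendre_eq_if_cong:
  assumes "prime p" "2 < p" "x \<in> {-1, 0, 1}" "y \<in> {-1, 0, 1 :: int}" "[x = y] (mod int p)"
  shows "x = y"
proof (rule ccontr)
  assume "x \<noteq> y"
  have "int p dvd \<bar>x - y\<bar>" using assms(5) by (simp add: cong_iff_dvd_diff)
  with \<open>x \<noteq> y\<close> have "int p \<le> \<bar>x - y\<bar>" by (intro zdvd_imp_le) auto
  moreover have "\<bar>x - y\<bar> \<le> 2" using assms(3,4) by auto
  ultimately show False using assms(2) by linarith
qed

lemma Legendre_mult:
  assumes "prime p" "2 < p"
  shows "Legendre (a * b) (int p) = Legendre a p * Legendre b p"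
proof (rule Legendre_eq_if_cong[OF assms])
  show "Legendre a p * Legendre b p \<in> {-1, 0, 1}" by (auto simp: Legendre_def)
  have "[Legendre (a * b) p = a ^ ((p - 1) div 2) * b ^ ((p - 1) div 2)] (mod p)"
    using euler_criterion[OF assms, of "a * b"] by (simp add: power_mult_distrib)
  also have "[a ^ ((p - 1) div 2) * b ^ ((p - 1) div 2) = Legendre a p * Legendre b p] (mod p)"
    using assms by (intro cong_mult cong_sym[OF euler_criterion])
  finally show "[Legendre (a * b) p = Legendre a p * Legendre b p] (mod p)" .
qed (rule Legendre_vals)

lemma Legendre_cong: "[a = b] (mod p) \<Longrightarrow> Legendre a p = Legendre b p"
  by (simp add: Legendre_def QuadRes_def cong_def)

lemma Legendre_one: "1 < p \<Longrightarrow> Legendre 1 p = 1"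
  by (auto simp: Legendre_def QuadRes_def cong_def intro!: exI[of _ 1])

lemma Legendre_eq_0_iff: "Legendre a p = 0 \<longleftrightarrow> p dvd a"
  by (simp add: Legendre_def cong_0_iff)

lemma Legendre_minus_one:
  assumes "prime p" "2 < p"
  shows "Legendre (-1) (int p) = (-1) ^ ((p - 1) div 2)"
proof (rule Legendre_eq_if_cong[OF assms Legendre_vals _ euler_criterion[OF assms]])
  show "(-1) ^ ((p - 1) div 2) \<in> {-1, 0, 1 :: int}" by (simp add: minus_one_power_iff)
qed

text \<open>Gauss's lemma: for \<open>q = 8 * j + 7\<close>, the doubles \<open>2 * i\<close>
  exceeding \<open>(q - 1) / 2 = 4 * j + 3\<close> are those with \<open>i\<close> from
  \<open>2 * j + 2\<close> to \<open>4 * j + 3\<close>, an even number of them.\<close>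

lemma Legendre_two:
  assumes "prime q" "q mod 8 = 7"
  shows "Legendre 2 (int q) = 1"
proof -
  obtain j where q: "q = 8 * j + 7" using assms(2) by (metis mult_div_mod_eq)
  interpret GAUSS q 2
  proof
    show "[2 \<noteq> 0] (mod int q)" unfolding cong_0_iff using q by (auto dest!: zdvd_imp_le)
  qed (use assms q in auto)
  have h: "(int q - 1) div 2 = 4 * int j + 3" unfolding q by simp
  have "E = (\<lambda>i. 2 * i) ` {2 * int j + 2..4 * int j + 3}"
  proof -
    have C: "C = (\<lambda>i. 2 * i) ` {0<..4 * int j + 3}"
      unfolding C_def B_def A_def h image_image
      by (intro image_cong refl) (auto simp: q mult.commute)
    show ?thesis unfolding E_def C h by auto
  qed
  then have "card E = 2 * j + 2"
    by (subst \<open>E = _\<close>, subst card_image) (auto simp: inj_on_def nat_add_distrib nat_mult_distrib)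
  then show ?thesis using gauss_lemma by simp
qed

text \<open>As \<open>(q - 1) / 2\<close> is odd, the reciprocity sign depends on \<open>l\<close>
  alone and equals \<open>(-1/l)\<close>, which can be moved into the upper argument.\<close>

lemma Legendre_reciprocity_7:
  assumes q: "prime q" "q mod 8 = 7" and l: "prime l" "2 < l" "l \<noteq> q"
  shows "Legendre (int l) (int q) = Legendre (- int q) (int l)"
proof -
  have q2: "2 < q" using q(2) by (cases "q = 0 \<or> q = 1 \<or> q = 2") auto
  obtain j where "q = 8 * j + 7" using q(2) by (metis mult_div_mod_eq)
  then have odd: "odd ((q - 1) div 2)" by simp
  have "Legendre l q * Legendre q l = (-1) ^ ((l - 1) div 2 * ((q - 1) div 2))"
    using Quadratic_Reciprocity[OF l(1,2) q(1) q2 l(3)] .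
  also have "\<dots> = (-1) ^ ((l - 1) div 2)" using odd by (simp add: minus_one_power_iff)
  also have "\<dots> = Legendre (-1) l" using Legendre_minus_one[OF l(1,2)] by simp
  finally have 1: "Legendre l q * Legendre q l = Legendre (-1) l" .
  have "\<not> int l dvd int q" using q l by (simp add: primes_dvd_imp_eq) (metis primes_dvd_imp_eq)
  then have 2: "Legendre q l \<in> {-1, 1}" using Legendre_vals[of q l] Legendre_eq_0_iff[of q l] by auto
  have "Legendre (- int q) l = Legendre (-1) l * Legendre q l"
    using Legendre_mult[OF l(1,2), of "-1" "int q"] by simp
  then show ?thesis using 1 2 by auto
qed

text \<open>Otherwise squaring would be surjective, hence injective, on the nonzero residues; but 1
  and -1 have the same square.\<close>

lemma ex_nonresidue:
  assumes "prime p" "2 < p"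
  shows "\<exists>g. Legendre (int g) (int p) = -1"
proof (rule ccontr)
  assume contra: "\<not> ?thesis"
  define f where "f x = x ^ 2 mod p" for x
  have "{1..<p} \<subseteq> f ` {1..<p}"
  proof
    fix a assume a: "a \<in> {1..<p}"
    then have "\<not> p dvd a" using nat_dvd_not_less by auto
    then have "Legendre (int a) p = 1"
      using contra Legendre_vals[of a p] Legendre_eq_0_iff[of a p] by auto
    then obtain y where y: "[y ^ 2 = int a] (mod p)"
      by (auto simp: Legendre_def QuadRes_def split: if_splits)
    define x where "x = nat (y mod p)"
    have x: "int x = y mod p" "x < p" using assms by (auto simp: x_def nat_less_iff)
    have "[int (x ^ 2) = int a] (mod p)"
      using y x(1) by (simp add: cong_def power_mod)
    then have "[x ^ 2 = a] (mod p)" by (simp only: cong_int_iff)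
    then have fx: "f x = a" using a by (simp add: f_def cong_def)
    then have "x \<noteq> 0" using a by (intro notI) (simp add: f_def)
    with x fx show "a \<in> f ` {1..<p}" by auto
  qed
  moreover have "finite {1..<p}" by simp
  ultimately have "inj_on f {1..<p}" by (intro finite_surj_inj)
  moreover have "f (p - 1) = f 1"
  proof -
    have "[(int p - 1) ^ 2 = 1] (mod p)" by (simp add: cong_iff_dvd_diff power2_eq_square algebra_simps)
    then have "[int ((p - 1) ^ 2) = int (1 ^ 2)] (mod p)" using assms by (simp add: of_nat_diff)
    then show ?thesis unfolding f_def cong_int_iff by (simp add: cong_def)
  qed
  ultimately have "p - 1 = 1" using assms by (elim inj_onD) auto
  with assms show False by simp
qed

text \<open>On odd \<open>n\<close> these two are \<open>(-1/n)\<close> and \<open>(2/n)\<close>.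
  The first is tabulated modulo 8 as well, so that both share one period and one case
  analysis.\<close>

definition chi4 :: "nat \<Rightarrow> real" where
  "chi4 n = (if n mod 8 \<in> {1, 5} then 1 else if n mod 8 \<in> {3, 7} then -1 else 0)"

definition chi8 :: "nat \<Rightarrow> real" where
  "chi8 n = (if n mod 8 \<in> {1, 7} then 1 else if n mod 8 \<in> {3, 5} then -1 else 0)"

lemma mod_8_cases: 
  obtains "n mod 8 = (0::nat)" | "n mod 8 = 1" | "n mod 8 = 2" | "n mod 8 = 3"
    | "n mod 8 = 4" | "n mod 8 = 5" | "n mod 8 = 6" | "n mod 8 = 7"
  using mod_less_divisor[of 8 n] by linarith

lemma chi4_chi8_mult: "chi4 (m * n) = chi4 m * chi4 n" "chi8 (m * n) = chi8 m * chi8 n"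
proof -
  have "m * n mod 8 = (m mod 8) * (n mod 8) mod 8" by (simp add: mod_mult_eq)
  then show "chi4 (m * n) = chi4 m * chi4 n" "chi8 (m * n) = chi8 m * chi8 n"
    by (cases rule: mod_8_cases[of m]; cases rule: mod_8_cases[of n]; simp add: chi4_def chi8_def)+
qed

lemma ex_prime_Legendre:
  fixes P :: "nat set" and \<epsilon> :: "nat \<Rightarrow> int"
  assumes P: "finite P" "\<And>l. l \<in> P \<Longrightarrow> prime l \<and> 2 < l"
    and sign: "\<And>l. l \<in> P \<Longrightarrow> \<epsilon> l \<in> {-1, 1}"
  shows "\<exists>q. prime q \<and> q mod 8 = 7 \<and> q \<notin> P \<and> (\<forall>l\<in>P. Legendre (int q) (int l) = \<epsilon> l)"
proof -
  \<comment> \<open>The labels 1 and 2 are free for \<open>chi4\<close> and \<open>chi8\<close>,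
    because \<open>P\<close> contains only primes above 2.\<close>
  define c where "c i n = (if i = 1 then chi4 n else if i = 2 then chi8 n
      else real_of_int (Legendre (int n) (int i)))" for i n :: nat
  define e where "e i = (if i = 1 then -1 else if i = 2 then 1 else real_of_int (\<epsilon> i))" for i :: nat
  define k where "k = 8 * \<Prod>P"
  have P12: "1 \<notin> P" "2 \<notin> P" using P(2) by fastforce+
  have cP: "c l n = real_of_int (Legendre (int n) (int l))" if "l \<in> P" for l n
    using that P12 by (auto simp: c_def)
  have dvd_k: "l dvd k" if "l \<in> P" for l using P(1) that by (auto simp: k_def dvd_prod_eqI)
  \<comment> \<open>The general lemma only excludes the value \<open>- e i\<close> and would
    tolerate 0. Removing 2 and the elements of \<open>P\<close> makes every character nonzero at
    \<open>q\<close>; then \<open>chi4 q = -1\<close> and \<open>chi8 q = 1\<close> mean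
    \<open>q mod 8 = 7\<close>.\<close>
  have "\<exists>q. prime q \<and> q \<notin> insert 2 P \<and> (\<forall>i\<in>{1, 2} \<union> P. c i q \<noteq> - e i)"
  proof (rule ex_prime_real_characters[where k = k])
    show "finite ({1, 2} \<union> P)" "finite (insert 2 P)" using P by auto
    show "0 < k" using P by (auto simp: k_def intro!: prod_pos dest: P(2))
    fix i assume i: "i \<in> {1, 2} \<union> P"
    show "c i 1 = 1" using i P(2)[of i] by (auto simp: c_def chi4_def chi8_def Legendre_one)
    show "c i (m * n) = c i m * c i n" for m n
      using i P(2)[of i] by (auto simp: c_def chi4_chi8_mult Legendre_mult)
    show "c i n \<in> {-1, 0, 1}" for n
      using Legendre_vals[of n i] by (auto simp: c_def chi4_def chi8_def)
    show "c i (n + k) = c i n" for n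
    proof -
      have "(n + k) mod 8 = n mod 8" by (simp add: k_def)
      moreover have "Legendre (int (n + k)) i = Legendre (int n) i" if "i \<in> P"
        using dvd_k[OF that] by (intro Legendre_cong) (auto simp: cong_iff_dvd_diff)
      ultimately show ?thesis using i by (auto simp: c_def chi4_def chi8_def)
    qed
    show "e i \<in> {-1, 1}" using i sign[of i] by (auto simp: e_def)
    have cop8: "coprime 8 (\<Prod>Q)" if "Q \<subseteq> P" for Q
    proof (intro prod_coprime_right)
      fix l assume "l \<in> Q"
      then have "prime l" "2 < l" using P(2) that by auto
      then show "coprime 8 l" using prime_odd_nat coprime_8_odd by blast
    qed
    have leg1: "c l u = 1" if "l \<in> P" "[u = 1] (mod l)" for l u
    proof -
      have "[int u = int 1] (mod int l)" using that by (simp only: cong_int_iff)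
      then have "Legendre (int u) l = Legendre 1 l" by (intro Legendre_cong) auto
      then show ?thesis using cP that P(2)[of l] by (simp add: Legendre_one)
    qed
    \<comment> \<open>Residue 7 modulo 8 changes the sign of \<open>chi4\<close> only, residue 5
      that of \<open>chi8\<close> only.\<close>
    have token: "\<exists>u. coprime u k \<and> u mod 8 = a \<and> (\<forall>l\<in>P. c l u = 1)" if "a \<in> {5, 7}" for a
    proof -
      obtain u where u: "[u = a] (mod 8)" "[u = 1] (mod \<Prod>P)"
        using binary_chinese_remainder_nat[OF cop8[of P], of a 1] by auto
      have "coprime u 8"
      proof -
        have "coprime a 8" using that coprime_8_odd[of a] by (auto simp: coprime_commute)
        then show ?thesis using u(1) cong_imp_coprime cong_sym coprime_commute by metis
      qed
      moreover have "coprime u (\<Prod>P)" using u(2) cong_imp_coprime[of 1 u "\<Prod>P"] cong_sym by auto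
      ultimately have "coprime u k" by (simp add: k_def)
      moreover have "u mod 8 = a" using u(1) that by (auto simp: cong_def)
      moreover have "c l u = 1" if "l \<in> P" for l
        using that P(1) u(2) by (intro leg1) (auto intro: cong_dvd_modulus_nat dvd_prod_eqI)
      ultimately show ?thesis by blast
    qed
    show "\<exists>u. coprime u k \<and> c i u = -1 \<and> (\<forall>j\<in>{1, 2} \<union> P - {i}. c j u = 1)"
    proof (cases "i \<in> P")
      case False
      with i consider "i = 1" | "i = 2" by auto
      then show ?thesis
      proof cases
        case 1
        obtain u where "coprime u k" "u mod 8 = 7" "\<forall>l\<in>P. c l u = 1" using token[of 7] by auto
        then show ?thesis using 1 by (intro exI[of _ u]) (auto simp: c_def chi4_def chi8_def)
      next
        case 2
        obtain u where "coprime u k" "u mod 8 = 5" "\<forall>l\<in>P. c l u = 1" using token[of 5] by auto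
        then show ?thesis using 2 by (intro exI[of _ u]) (auto simp: c_def chi4_def chi8_def)
      qed
    next
      case True
      note l = P(2)[OF True, THEN conjunct1] P(2)[OF True, THEN conjunct2]
      obtain g where g: "Legendre (int g) (int i) = -1" using ex_nonresidue[OF l] by auto
      define R where "R = 8 * \<Prod>(P - {i})"
      have "coprime i (\<Prod>(P - {i}))"
        using P(2) l by (intro prod_coprime_right) (auto simp: primes_coprime)
      moreover have "coprime i 8" using cop8[of "{i}"] True by (simp add: coprime_commute)
      ultimately have "coprime i R" by (simp add: R_def)
      then obtain u where u: "[u = g] (mod i)" "[u = 1] (mod R)"
        using binary_chinese_remainder_nat by blast
      have "[int u = int g] (mod int i)" using u(1) by (simp only: cong_int_iff)
      then have ui: "c i u = -1" using cP[OF True] g Legendre_cong by auto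
      have "\<not> i dvd u"
        using ui cP[OF True, of u] Legendre_eq_0_iff[of "int u" "int i"] by auto
      then have "coprime u i" using l(1) prime_imp_coprime coprime_commute by blast
      moreover have "coprime u R" using u(2) cong_imp_coprime[of 1 u R] cong_sym by auto
      moreover have "k = i * R" using P(1) True prod.remove[of P i "\<lambda>x. x"] by (simp add: k_def R_def)
      ultimately have "coprime u k" by simp
      moreover have "u mod 8 = 1"
      proof -
        have "[u = 1] (mod 8)" using u(2) by (rule cong_dvd_modulus_nat) (simp add: R_def)
        then show ?thesis by (simp add: cong_def)
      qed
      moreover have "\<forall>j\<in>P - {i}. c j u = 1"
      proof
        fix j assume that: "j \<in> P - {i}"
        show "c j u = 1"
      proof (rule leg1)
        have "j dvd \<Prod>(P - {i})" using that P(1) by (intro dvd_prodI[of "P - {i}" j "\<lambda>x. x"]) auto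
        then have "j dvd R" by (simp add: R_def)
        with u(2) show "[u = 1] (mod j)" by (rule cong_dvd_modulus_nat)
      qed (use that in auto)
      qed
      ultimately have "\<forall>j\<in>{1, 2} \<union> P - {i}. c j u = 1" 
        using cP by (auto simp: c_def chi4_def chi8_def)
      with \<open>coprime u k\<close> ui show ?thesis by blast
    qed
  qed
  then obtain q where q: "prime q" "q \<noteq> 2" "q \<notin> P" "\<And>i. i \<in> {1, 2} \<union> P \<Longrightarrow> c i q \<noteq> - e i" by auto
  have "odd q" using q prime_odd_nat[of q] prime_ge_2_nat[of q] by auto
  then have "q mod 8 = 7"
  proof -
    have "q mod 8 = 1 \<or> q mod 8 = 3 \<or> q mod 8 = 5 \<or> q mod 8 = 7" using \<open>odd q\<close> by presburger
    then show ?thesis using q(4)[of 1] q(4)[of 2] by (auto simp: c_def e_def chi4_def chi8_def)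
  qed
  moreover have "Legendre (int q) (int l) = \<epsilon> l" if l: "l \<in> P" for l
  proof -
    have "\<not> l dvd q" using q P(2)[OF l] l primes_dvd_imp_eq by blast
    then have "Legendre (int q) (int l) \<in> {-1, 1}"
      using Legendre_vals[of q l] Legendre_eq_0_iff[of q l] by auto
    moreover have "real_of_int (Legendre (int q) (int l)) \<noteq> - real_of_int (\<epsilon> l)"
    proof -
      have "l \<noteq> 1" "l \<noteq> 2" using l P12 by blast+
      then show ?thesis using q(4)[of l] l cP[OF l] by (simp add: e_def)
    qed
    ultimately show ?thesis using sign[OF l] by auto
  qed
  ultimately show ?thesis using q by blast
qed

lemma square_root_mod_squarefree:
  assumes "squarefree (m::nat)" "odd m" "\<And>l. prime l \<Longrightarrow> l dvd m \<Longrightarrow> Legendre a (int l) = 1"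
  shows "\<exists>b. int m dvd b ^ 2 - a"
  using assms
proof (induction m rule: less_induct)
  case (less m)
  show ?case
  proof (cases "m = 1")
    case False
    then obtain l where l: "prime l" "l dvd m" using prime_factor_nat by blast
    then obtain m' where m: "m = l * m'" by auto
    have "0 < m" using less.prems(2) by (cases m) auto
    then have "m' < m" using m prime_gt_1_nat[OF l(1)] by simp
    have "coprime l m'"
    proof (rule ccontr)
      assume "\<not> coprime l m'"
      then have "l dvd m'" using l(1) prime_imp_coprime by blast
      then have "l ^ 2 dvd m" unfolding m power2_eq_square by (intro mult_dvd_mono) auto
      then have "is_unit l" using less.prems(1) unfolding squarefree_def by blast
      with l(1) show False using not_prime_unit by blast
    qed
    have "\<exists>b. int m' dvd b ^ 2 - a"
    proof (rule less.IH[OF \<open>m' < m\<close>])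
      show "squarefree m'" using less.prems(1) m squarefree_mono[of m' m] by simp
      show "odd m'" using less.prems(2) m by simp
      show "Legendre a (int l') = 1" if "prime l'" "l' dvd m'" for l'
        using less.prems(3)[of l'] that m by simp
    qed
    then obtain b where b: "int m' dvd b ^ 2 - a" by auto
    have "QuadRes (int l) a" using less.prems(3)[OF l] by (auto simp: Legendre_def split: if_splits)
    then obtain y where y: "int l dvd y ^ 2 - a" by (auto simp: QuadRes_def cong_iff_dvd_diff)
    have "coprime (int l) (int m')" using \<open>coprime l m'\<close> by simp
    then obtain x where x: "[x = y] (mod int l)" "[x = b] (mod int m')"
      using binary_chinese_remainder_int by blast
    have "[x ^ 2 - a = y ^ 2 - a] (mod int l)" "[x ^ 2 - a = b ^ 2 - a] (mod int m')"
      by (rule cong_diff[OF cong_pow[OF x(1)] cong_refl], rule cong_diff[OF cong_pow[OF x(2)] cong_refl])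
    then have "int l dvd x ^ 2 - a" "int m' dvd x ^ 2 - a"
      using y b by (simp_all add: cong_dvd_iff)
    with \<open>coprime (int l) (int m')\<close> have "int l * int m' dvd x ^ 2 - a"
      by (intro divides_mult) auto
    then show ?thesis by (intro exI[of _ x]) (simp add: m)
  qed simp
qed

lemma Legendre_eq_1_if_prime_factors:
  assumes q: "prime q" "2 < q" and m: "0 < m"
    and "\<And>l. prime l \<Longrightarrow> l dvd m \<Longrightarrow> Legendre (int l) (int q) = 1"
  shows "Legendre (int m) (int q) = 1"
  using m assms(4)
proof (induction m rule: less_induct)
  case (less m)
  show ?case
  proof (cases "m = 1")
    case False
    then obtain l where l: "prime l" "l dvd m" using prime_factor_nat by blast
    then obtain m' where m: "m = l * m'" by auto
    have "0 < m'" "m' < m" using less.prems(1) m prime_gt_1_nat[OF l(1)] by (cases "m' = 0"; simp)+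
    moreover have "Legendre (int m') q = 1"
      using less.prems(2) m by (intro less.IH[OF \<open>m' < m\<close> \<open>0 < m'\<close>]) simp
    ultimately show ?thesis
      using less.prems(2)[OF l] by (simp add: m Legendre_mult[OF q])
  qed (use q in \<open>simp add: Legendre_one\<close>)
qed

text \<open>The congruence \<open>q \<equiv> 7 (mod 8)\<close> makes \<open>(l/q) = (-q/l)\<close> for all odd primes \<open>l\<close>, and \<open>(2/q) = 1\<close>.
  Hence \<open>(-nD/q) = (-1/q) (p/q) = 1\<close>.\<close>

lemma ex_auxiliary_prime:
  fixes n D' p :: nat
  assumes n: "squarefree n" "\<not> p dvd n" and p: "prime p" "2 < p" and D': "0 < D'" "\<not> p dvd D'"
  shows "\<exists>q b e. prime q \<and> odd q \<and> coprime q n \<and> Legendre (- int q) (int p) = -1 \<and>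
           4 * int n dvd b ^ 2 + int q \<and> int q dvd e ^ 2 + 4 * int n * int (p * D')"
proof -
  define P where "P = insert p {l. prime l \<and> 2 < l \<and> l dvd n * D'}"
  \<comment> \<open>Chosen so that \<open>(-q/l) = 1\<close> for the odd primes \<open>l\<close>
    dividing \<open>n * D'\<close>, while \<open>(-q/p) = -1\<close>.\<close>
  define \<epsilon> where "\<epsilon> l = (if l = p then - Legendre (-1) (int p) else Legendre (-1) (int l))" for l :: nat
  have n0: "0 < n" using n(1) by (intro Nat.gr0I) auto
  have "finite {l. l dvd n * D'}" using n0 D' by simp
  then have "finite {l. prime l \<and> 2 < l \<and> l dvd n * D'}" by (rule rev_finite_subset) auto
  then have finP: "finite P" by (simp add: P_def)
  have Pp: "prime l \<and> 2 < l" if "l \<in> P" for l using that p by (auto simp: P_def)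
  have \<epsilon>: "\<epsilon> l \<in> {-1, 1}" if "l \<in> P" for l
    using Legendre_minus_one[of l] Pp[OF that] p by (auto simp: \<epsilon>_def minus_one_power_iff split: if_splits)
  have "\<exists>q. prime q \<and> q mod 8 = 7 \<and> q \<notin> P \<and> (\<forall>l\<in>P. Legendre (int q) (int l) = \<epsilon> l)"
    using Pp \<epsilon> by (rule ex_prime_Legendre[OF finP])
  then obtain q where q: "prime q" "q mod 8 = 7" "q \<notin> P" "\<And>l. l \<in> P \<Longrightarrow> Legendre (int q) (int l) = \<epsilon> l"
    by blast
  have q2: "2 < q" using q(2) by (cases "q = 0 \<or> q = 1 \<or> q = 2") auto
  have "odd q" using q(2) by presburger
  have neg: "Legendre (- int q) (int l) = (if l = p then -1 else 1)" if "l \<in> P" for l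
  proof -
    have "Legendre (- int q) l = Legendre (-1) l * Legendre q l"
      using Legendre_mult[of l "-1" "int q"] Pp[OF that] by simp
    moreover have "Legendre (-1) l * Legendre (-1) l = 1"
      using Legendre_minus_one[of l] Pp[OF that] by (auto simp: minus_one_power_iff)
    ultimately show ?thesis using q(4)[OF that] by (auto simp: \<epsilon>_def)
  qed
  have flip: "Legendre (int l) (int q) = (if l = p then -1 else 1)" if "l \<in> P" for l
  proof -
    have "l \<noteq> q" using that q(3) by blast
    then show ?thesis using Legendre_reciprocity_7[OF q(1,2), of l] neg[OF that] Pp[OF that] by simp
  qed
  have fac: "Legendre (int l) (int q) = 1" if "prime l" "l dvd n * D'" for l
  proof (cases "l = 2")
    case True
    then show ?thesis using Legendre_two[OF q(1,2)] by simp
  next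
    case False
    then have "l \<in> P" using that prime_ge_2_nat[of l] by (auto simp: P_def)
    moreover have "l \<noteq> p" using that n(2) D'(2) p(1) prime_dvd_mult_iff by blast
    ultimately show ?thesis using flip by simp
  qed
  have "Legendre (int (n * D')) (int q) = 1"
    using n0 D'(1) by (intro Legendre_eq_1_if_prime_factors[OF q(1) q2 _ fac]) simp
  moreover have "Legendre (int p) (int q) = -1" using flip[of p] by (simp add: P_def)
  moreover have "Legendre (-1) (int q) = -1"
  proof -
    obtain j where "q = 8 * j + 7" using q(2) by (metis mult_div_mod_eq)
    then have "odd ((q - 1) div 2)" by simp
    then show ?thesis using Legendre_minus_one[OF q(1) q2] by (simp add: minus_one_power_iff)
  qed
  ultimately have "Legendre ((-1) * (int p * int (n * D'))) (int q) = 1"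
    by (simp only: Legendre_mult[OF q(1) q2])
  moreover have "(-1) * (int p * int (n * D')) = - (int n * int (p * D'))" by simp
  ultimately have "Legendre (- (int n * int (p * D'))) (int q) = 1" by metis
  then have "QuadRes (int q) (- (int n * int (p * D')))" by (simp add: Legendre_def split: if_splits)
  then obtain y where "int q dvd y ^ 2 - - (int n * int (p * D'))"
    unfolding QuadRes_def cong_iff_dvd_diff by blast
  then have "int q dvd 4 * (y ^ 2 - - (int n * int (p * D')))" by (rule dvd_mult)
  moreover have "4 * (y ^ 2 - - (int n * int (p * D'))) = (2 * y) ^ 2 + 4 * int n * int (p * D')"
    by (simp add: power2_eq_square)
  ultimately have e: "int q dvd (2 * y) ^ 2 + 4 * int n * int (p * D')" by metis
  have copr: "coprime q n"
  proof (rule ccontr)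
    assume "\<not> coprime q n"
    then have "q dvd n" using q(1) prime_imp_coprime by blast
    then have "q \<in> P" using q(1) q2 by (auto simp: P_def)
    with q(3) show False by simp
  qed
  \<comment> \<open>\<open>m\<close> is the odd part of \<open>n\<close>; squarefreeness allows at
    most one factor 2 besides it. Thus \<open>4 * n\<close> divides \<open>8 * m\<close>, and the
    moduli 8 and \<open>m\<close> can be treated separately.\<close>
  obtain m where m: "odd m" "m dvd n" "n dvd 2 * m"
  proof (cases "even n")
    case True
    then obtain m where m: "n = 2 * m" by (elim evenE)
    have "odd m"
    proof
      assume "even m"
      then obtain j where "m = 2 * j" by (elim evenE)
      then have "2 ^ 2 dvd n" using m by simp
      then show False using squarefreeD[OF n(1), of 2] by simp
    qed
    then show ?thesis by (rule that) (simp_all add: m)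
  next
    case False
    then show ?thesis by (rule that) simp_all
  qed
  have "\<exists>b. int m dvd b ^ 2 - - int q"
  proof (rule square_root_mod_squarefree[OF _ m(1)])
    show "squarefree m" using n(1) m(2) squarefree_mono by blast
    fix l assume l: "prime l" "l dvd m"
    have "l \<noteq> 2" using l m(1) by blast
    moreover have "l dvd n" using l(2) m(2) by (rule dvd_trans)
    ultimately have "l \<in> P" "l \<noteq> p" using l(1) n(2) prime_ge_2_nat[of l] by (auto simp: P_def)
    then show "Legendre (- int q) (int l) = 1" using neg by simp
  qed
  then obtain b0 where b0: "int m dvd b0 ^ 2 + int q" by auto
  \<comment> \<open>Adding the odd modulus \<open>m\<close> repairs the parity. An odd
    \<open>b\<close> has square 1 modulo 8, which cancels \<open>q\<close> congruent to 7.\<close>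
  obtain b where b: "odd b" "int m dvd b ^ 2 + int q"
  proof (cases "odd b0")
    case False
    have "int m dvd (b0 ^ 2 + int q) + int m * (2 * b0 + int m)" by (rule dvd_add[OF b0 dvd_triv_left])
    then have "int m dvd (b0 + int m) ^ 2 + int q" by (simp add: power2_eq_square algebra_simps)
    then show ?thesis using that[of "b0 + int m"] False m(1) by simp
  qed (use that b0 in blast)
  have "8 dvd b ^ 2 + int q"
  proof -
    obtain c where c: "b = 2 * c + 1" using b(1) by (elim oddE)
    obtain j where j: "q = 8 * j + 7" using q(2) by (metis mult_div_mod_eq)
    have "even (c * (c + 1))" by simp
    then obtain d where d: "c * (c + 1) = 2 * d" by (elim evenE)
    have "b ^ 2 + int q = 4 * (c * (c + 1)) + 8 + 8 * int j"
      unfolding c j by (simp add: power2_eq_square algebra_simps)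
    then show ?thesis unfolding d by simp
  qed
  moreover have "coprime 8 (int m)"
  proof -
    have "coprime (int 8) (int m)" using coprime_8_odd[OF m(1)] by (simp only: coprime_int_iff)
    then show ?thesis by simp
  qed
  ultimately have "8 * int m dvd b ^ 2 + int q" using b(2) by (intro divides_mult)
  moreover have "4 * int n dvd 8 * int m"
  proof -
    have "int n dvd int (2 * m)" using m(3) by (simp only: int_dvd_int_iff)
    then have "4 * int n dvd 4 * int (2 * m)" by (rule mult_dvd_mono[OF dvd_refl])
    then show ?thesis by simp
  qed
  ultimately have "4 * int n dvd b ^ 2 + int q" by (rule dvd_trans[rotated])
  moreover have "Legendre (- int q) (int p) = -1" using neg[of p] by (simp add: P_def)
  ultimately show ?thesis using q(1) \<open>odd q\<close> copr e by blast
qed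

section \<open>Reduction of ternary forms\<close>

fun qf :: "int \<Rightarrow> int \<Rightarrow> int \<Rightarrow> int \<Rightarrow> int \<Rightarrow> int \<Rightarrow> int \<times> int \<times> int \<Rightarrow> int" where
  "qf a b c r s t (x, y, z) = a * x^2 + b * y^2 + c * z^2 + r * y * z + s * x * z + t * x * y"

text \<open>Half the determinant of the Gram matrix of \<open>qf a b c r s t\<close>.\<close>

definition half_disc :: "int \<Rightarrow> int \<Rightarrow> int \<Rightarrow> int \<Rightarrow> int \<Rightarrow> int \<Rightarrow> int" where
  "half_disc a b c r s t = 4 * a * b * c + r * s * t - a * r^2 - b * s^2 - c * t^2"

definition pos_def :: "(int \<times> int \<times> int \<Rightarrow> int) \<Rightarrow> bool" where
  "pos_def F \<longleftrightarrow> (\<forall>v. v \<noteq> 0 \<longrightarrow> 0 < F v)"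

text \<open>Additive bijections of the integer triples are exactly the unimodular substitutions. In
  this form composition and equality of ranges need no matrices.\<close>

definition eqv :: "(int \<times> int \<times> int \<Rightarrow> int) \<Rightarrow> (int \<times> int \<times> int \<Rightarrow> int) \<Rightarrow> bool" where
  "eqv F G \<longleftrightarrow> (\<exists>\<phi>. bij \<phi> \<and> (\<forall>v w. \<phi> (v + w) = \<phi> v + \<phi> w) \<and> G = F \<circ> \<phi>)"

text \<open>\<open>4 * a * b - t^2\<close>, \<open>4 * a * r - 2 * s * t\<close> and
  \<open>4 * a * c - s^2\<close> are the coefficients \<open>A\<close>, \<open>B\<close>,
  \<open>C\<close> of the binary form left after completing the square in \<open>x\<close>; it has
  to satisfy \<open>\<bar>B\<bar> \<le> A \<le> C\<close>. The two available sign changes are spent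
  on \<open>s\<close> and \<open>t\<close>, so \<open>r\<close> keeps its sign.\<close>

definition reduced :: "int \<Rightarrow> int \<Rightarrow> int \<Rightarrow> int \<Rightarrow> int \<Rightarrow> int \<Rightarrow> bool" where
  "reduced a b c r s t \<longleftrightarrow> 0 < a \<and> 0 \<le> t \<and> t \<le> a \<and> 0 \<le> s \<and> s \<le> a \<and> 3 * a^2 \<le> 4 * a * b - t^2 \<and>
     \<bar>4 * a * r - 2 * s * t\<bar> \<le> 4 * a * b - t^2 \<and> 4 * a * b - t^2 \<le> 4 * a * c - s^2"

lemma eqv_refl: "eqv F F"
  unfolding eqv_def by (intro exI[of _ id]) auto

lemma eqv_trans: "eqv F G \<Longrightarrow> eqv G H \<Longrightarrow> eqv F H"
proof -
  assume "eqv F G" "eqv G H"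
  then obtain \<phi> \<psi> where "bij \<phi>" "\<And>v w. \<phi> (v + w) = \<phi> v + \<phi> w" "G = F \<circ> \<phi>"
    "bij \<psi>" "\<And>v w. \<psi> (v + w) = \<psi> v + \<psi> w" "H = G \<circ> \<psi>"
    unfolding eqv_def by blast
  then show "eqv F H" unfolding eqv_def by (intro exI[of _ "\<phi> \<circ> \<psi>"]) (simp add: bij_comp comp_assoc)
qed

lemma eqv_range: "eqv F G \<Longrightarrow> range G = range F"
  unfolding eqv_def by (metis bij_is_surj image_comp)

lemma eqv_pos_def:
  assumes "eqv F G" "pos_def F" shows "pos_def G"
proof -
  obtain \<phi> where \<phi>: "bij \<phi>" "\<And>v w. \<phi> (v + w) = \<phi> v + \<phi> w" "G = F \<circ> \<phi>"
    using assms(1) unfolding eqv_def by blast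
  have "\<phi> 0 = 0" using \<phi>(2)[of 0 0] by simp
  then have "\<phi> v \<noteq> 0" if "v \<noteq> 0" for v 
    using inj_eq[OF bij_is_inj[OF \<phi>(1)], of v 0] that by simp
  with assms(2) show ?thesis unfolding pos_def_def \<phi>(3) comp_apply by blast
qed

lemma eqv_congruence:
  assumes "eqv F G" "\<And>v w. p dvd F v \<Longrightarrow> p dvd F (v + w) - F w" "p dvd G v"
  shows "p dvd G (v + w) - G w"
proof -
  obtain \<phi> where "\<And>v w. \<phi> (v + w) = \<phi> v + \<phi> w" "G = F \<circ> \<phi>"
    using assms(1) unfolding eqv_def by blast
  then show ?thesis using assms(2)[of "\<phi> v" "\<phi> w"] assms(3) by simp
qed

lemma eqvI:
  assumes "\<And>v. \<psi> (\<phi> v) = v" "\<And>v. \<phi> (\<psi> v) = v" "\<And>v w. \<phi> (v + w) = \<phi> v + \<phi> w" "\<And>v. F (\<phi> v) = G v"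
  shows "eqv F G"
  unfolding eqv_def using assms
  by (intro exI[of _ \<phi>] conjI o_bij[of \<psi>]) (auto simp: fun_eq_iff)

lemma eqv_elementary:
  shows "eqv (qf a b c r s t) (qf b a c s r t)"
    and "eqv (qf a b c r s t) (qf a c b r t s)"
    and "eqv (qf a b c r s t) (qf a b c (- r) s (- t))"
    and "eqv (qf a b c r s t) (qf a b c (- r) (- s) t)"
    and "eqv (qf a b c r s t) (qf a (b + t * k + a * k^2) c (r + s * k) s (t + 2 * a * k))"
    and "eqv (qf a b c r s t) (qf a b (c + s * k + a * k^2) (r + t * k) (s + 2 * a * k) t)"
    and "eqv (qf a b c r s t) (qf a b (c + r * k + b * k^2) (r + 2 * b * k) (s + t * k) t)"
proof -
  show "eqv (qf a b c r s t) (qf b a c s r t)"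
    by (rule eqvI[of "\<lambda>(x, y, z). (y, x, z)" "\<lambda>(x, y, z). (y, x, z)"]) auto
  show "eqv (qf a b c r s t) (qf a c b r t s)"
    by (rule eqvI[of "\<lambda>(x, y, z). (x, z, y)" "\<lambda>(x, y, z). (x, z, y)"]) auto
  show "eqv (qf a b c r s t) (qf a b c (- r) s (- t))"
    by (rule eqvI[of "\<lambda>(x, y, z). (x, - y, z)" "\<lambda>(x, y, z). (x, - y, z)"]) auto
  show "eqv (qf a b c r s t) (qf a b c (- r) (- s) t)"
    by (rule eqvI[of "\<lambda>(x, y, z). (x, y, - z)" "\<lambda>(x, y, z). (x, y, - z)"]) auto
  show "eqv (qf a b c r s t) (qf a (b + t * k + a * k^2) c (r + s * k) s (t + 2 * a * k))"
    by (rule eqvI[of "\<lambda>(x, y, z). (x - k * y, y, z)" "\<lambda>(x, y, z). (x + k * y, y, z)"])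
       (auto simp: algebra_simps power2_eq_square)
  show "eqv (qf a b c r s t) (qf a b (c + s * k + a * k^2) (r + t * k) (s + 2 * a * k) t)"
    by (rule eqvI[of "\<lambda>(x, y, z). (x - k * z, y, z)" "\<lambda>(x, y, z). (x + k * z, y, z)"])
       (auto simp: algebra_simps power2_eq_square)
  show "eqv (qf a b c r s t) (qf a b (c + r * k + b * k^2) (r + 2 * b * k) (s + t * k) t)"
    by (rule eqvI[of "\<lambda>(x, y, z). (x, y - k * z, z)" "\<lambda>(x, y, z). (x, y + k * z, z)"])
       (auto simp: algebra_simps power2_eq_square)
qed

lemma half_disc_elementary:
  "half_disc b a c s r t = half_disc a b c r s t"
  "half_disc a c b r t s = half_disc a b c r s t"
  "half_disc a b c (- r) s (- t) = half_disc a b c r s t"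
  "half_disc a b c (- r) (- s) t = half_disc a b c r s t"
  "half_disc a (b + t * k + a * k^2) c (r + s * k) s (t + 2 * a * k) = half_disc a b c r s t"
  "half_disc a b (c + s * k + a * k^2) (r + t * k) (s + 2 * a * k) t = half_disc a b c r s t"
  "half_disc a b (c + r * k + b * k^2) (r + 2 * b * k) (s + t * k) t = half_disc a b c r s t"
  unfolding half_disc_def by (simp_all add: power2_eq_square algebra_simps)

lemma ex_least_abs_residue:
  assumes "0 < (m::int)"
  shows "\<exists>k. \<bar>x + 2 * m * k\<bar> \<le> m"
proof -
  define k where "k = - ((x + m) div (2 * m))"
  have "x + 2 * m * k = (x + m) mod (2 * m) - m"
    unfolding k_def using minus_mult_div_eq_mod[of "x + m" "2 * m"] by simp
  moreover have "0 \<le> (x + m) mod (2 * m)" "(x + m) mod (2 * m) < 2 * m" using assms by auto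
  ultimately show ?thesis by (intro exI[of _ k]) linarith
qed

lemma pos_def_minors:
  assumes "pos_def (qf a b c r s t)"
  shows "0 < a" "0 < 4 * a * b - t^2" "0 < 4 * a * c - s^2"
proof -
  have p: "v \<noteq> (0, 0, 0) \<Longrightarrow> 0 < qf a b c r s t v" for v
    using assms unfolding pos_def_def zero_prod_def by blast
  show a: "0 < a" using p[of "(1, 0, 0)"] by simp
  \<comment> \<open>The vector \<open>(- t, 2 * a, 0)\<close> is a zero of the linear form
    \<open>2 * a * x + t * y + s * z\<close>, so only the binary part contributes.\<close>
  have "0 < a * (4 * a * b - t^2)" using p[of "(- t, 2 * a, 0)"] a
    by (simp add: power2_eq_square algebra_simps)
  then show "0 < 4 * a * b - t^2" using a zero_less_mult_pos by blast
  have "0 < a * (4 * a * c - s^2)" using p[of "(- s, 0, 2 * a)"] a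
    by (simp add: power2_eq_square algebra_simps)
  then show "0 < 4 * a * c - s^2" using a zero_less_mult_pos by blast
qed

text \<open>Hermite reduction: minimise first \<open>a\<close>, then the leading coefficient of the binary form
  \<open>4 a Q - (2 a x + t y + s z)\<^sup>2\<close>.\<close>

theorem ex_reduced:
  assumes pd: "pos_def (qf a0 b0 c0 r0 s0 t0)"
  shows "\<exists>a b c r s t. reduced a b c r s t \<and> eqv (qf a0 b0 c0 r0 s0 t0) (qf a b c r s t) \<and>
           half_disc a b c r s t = half_disc a0 b0 c0 r0 s0 t0"
proof -
  define R where "R a b c r s t \<longleftrightarrow> eqv (qf a0 b0 c0 r0 s0 t0) (qf a b c r s t) \<and>
    half_disc a b c r s t = half_disc a0 b0 c0 r0 s0 t0" for a b c r s t
  have R0: "R a0 b0 c0 r0 s0 t0" by (simp add: R_def eqv_refl)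
  have step: "R a' b' c' r' s' t'" if "R a b c r s t" "eqv (qf a b c r s t) (qf a' b' c' r' s' t')"
    "half_disc a' b' c' r' s' t' = half_disc a b c r s t" for a b c r s t a' b' c' r' s' t'
    using that eqv_trans[of _ "qf a b c r s t"] unfolding R_def by simp
  have elem: "R b a c s r t" "R a c b r t s" "R a b c (- r) s (- t)" "R a b c (- r) (- s) t"
    "R a (b + t * k + a * k^2) c (r + s * k) s (t + 2 * a * k)"
    "R a b (c + s * k + a * k^2) (r + t * k) (s + 2 * a * k) t"
    "R a b (c + r * k + b * k^2) (r + 2 * b * k) (s + t * k) t" if "R a b c r s t" for a b c r s t k
    using step[OF that eqv_elementary(1) half_disc_elementary(1)]
      step[OF that eqv_elementary(2) half_disc_elementary(2)]
      step[OF that eqv_elementary(3) half_disc_elementary(3)]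
      step[OF that eqv_elementary(4) half_disc_elementary(4)]
      step[OF that eqv_elementary(5) half_disc_elementary(5)]
      step[OF that eqv_elementary(6) half_disc_elementary(6)]
      step[OF that eqv_elementary(7) half_disc_elementary(7)] .
  have pos: "0 < a" "0 < 4 * a * b - t^2" "0 < 4 * a * c - s^2" if "R a b c r s t" for a b c r s t
    using pos_def_minors[OF eqv_pos_def[OF _ pd], of a b c r s t] that by (simp_all add: R_def)
  define PA where "PA j \<longleftrightarrow> (\<exists>b c r s t. R (int j) b c r s t)" for j
  have PA: "PA (nat a')" if "R a' b c r s t" for a' b c r s t
  proof -
    have "int (nat a') = a'" using pos(1)[OF that] by simp
    with that show ?thesis unfolding PA_def by metis
  qed
  define a where "a = int (Least PA)"
  have PA_Least: "PA (Least PA)" using PA[OF R0] by (rule LeastI)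
  have a_min: "a \<le> a'" if "R a' b c r s t" for a' b c r s t
  proof -
    have "Least PA \<le> nat a'" using PA[OF that] by (rule Least_le)
    then show ?thesis using pos(1)[OF that] by (simp add: a_def)
  qed
  define PB where "PB j \<longleftrightarrow> (\<exists>b c r s t. R a b c r s t \<and> 4 * a * b - t^2 = int j)" for j
  have PB: "PB (nat (4 * a * b - t^2))" if "R a b c r s t" for b c r s t
  proof -
    have "4 * a * b - t^2 = int (nat (4 * a * b - t^2))" using pos(2)[OF that] by simp
    with that show ?thesis unfolding PB_def by blast
  qed
  obtain b c r s t where "R a b c r s t" using PA_Least unfolding PA_def a_def by blast
  then have "PB (Least PB)" using PB LeastI by blast
  then obtain b c r s t where R1: "R a b c r s t" and A1: "4 * a * b - t^2 = int (Least PB)"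
    unfolding PB_def by blast
  define A where "A = 4 * a * b - t^2"
  have A_min: "A \<le> 4 * a * b' - t'^2" if "R a b' c' r' s' t'" for b' c' r' s' t'
    using Least_le[of PB, OF PB[OF that]] pos(2)[OF that] by (simp add: A_def A1)
  have A_pos: "0 < A" "0 < a" using pos[OF R1] by (auto simp: A_def)
  obtain k where k: "\<bar>(4 * a * r - 2 * s * t) + 2 * A * k\<bar> \<le> A" using ex_least_abs_residue[OF A_pos(1)] by blast
  define c2 r2 s2 where "c2 = c + r * k + b * k^2" and "r2 = r + 2 * b * k" and "s2 = s + t * k"
  have R2: "R a b c2 r2 s2 t" using elem(7)[OF R1] by (simp add: c2_def r2_def s2_def)
  have B2: "\<bar>4 * a * r2 - 2 * s2 * t\<bar> \<le> A"
  proof -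
    have "4 * a * r2 - 2 * s2 * t = (4 * a * r - 2 * s * t) + 2 * A * k"
      unfolding r2_def s2_def A_def by (simp add: power2_eq_square power3_eq_cube algebra_simps)
    with k show ?thesis by simp
  qed
  \<comment> \<open>Shearing \<open>x\<close> along \<open>y\<close> or \<open>z\<close> leaves the
    binary form unchanged. So \<open>t\<close> and \<open>s\<close> can be made small without
    spoiling the bound already achieved for its middle coefficient.\<close>
  obtain l where l: "\<bar>t + 2 * a * l\<bar> \<le> a" using ex_least_abs_residue[OF A_pos(2)] by blast
  define b3 r3 t3 where "b3 = b + t * l + a * l^2" and "r3 = r2 + s2 * l" and "t3 = t + 2 * a * l"
  have R3: "R a b3 c2 r3 s2 t3" using elem(5)[OF R2] by (simp add: b3_def r3_def t3_def)
  have A3: "4 * a * b3 - t3^2 = A" unfolding b3_def t3_def A_def by (simp add: power2_eq_square power3_eq_cube algebra_simps)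
  have B3: "4 * a * r3 - 2 * s2 * t3 = 4 * a * r2 - 2 * s2 * t" unfolding r3_def t3_def by (simp add: power2_eq_square power3_eq_cube algebra_simps)
  obtain m where m: "\<bar>s2 + 2 * a * m\<bar> \<le> a" using ex_least_abs_residue[OF A_pos(2)] by blast
  define c4 r4 s4 where "c4 = c2 + s2 * m + a * m^2" and "r4 = r3 + t3 * m" and "s4 = s2 + 2 * a * m"
  have R4: "R a b3 c4 r4 s4 t3" using elem(6)[OF R3] by (simp add: c4_def r4_def s4_def)
  have B4: "4 * a * r4 - 2 * s4 * t3 = 4 * a * r3 - 2 * s2 * t3" unfolding r4_def s4_def by (simp add: power2_eq_square power3_eq_cube algebra_simps)
  define \<sigma> \<tau> :: int where "\<sigma> = (if t3 < 0 then -1 else 1)" and "\<tau> = (if s4 < 0 then -1 else 1)"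
  have R5: "R a b3 c4 (\<sigma> * r4) s4 (\<sigma> * t3)" using R4 elem(3)[OF R4] by (simp add: \<sigma>_def)
  have R6: "R a b3 c4 (\<tau> * (\<sigma> * r4)) (\<tau> * s4) (\<sigma> * t3)" using R5 elem(4)[OF R5] by (simp add: \<tau>_def)
  have sq: "\<sigma>^2 = 1" "\<tau>^2 = 1" by (auto simp: \<sigma>_def \<tau>_def)
  have A6: "4 * a * b3 - (\<sigma> * t3)^2 = A" using A3 by (simp add: power_mult_distrib sq)
  have "\<bar>4 * a * (\<tau> * (\<sigma> * r4)) - 2 * (\<tau> * s4) * (\<sigma> * t3)\<bar> = \<bar>\<tau> * \<sigma> * (4 * a * r4 - 2 * s4 * t3)\<bar>"
    by (simp add: algebra_simps)
  also have "\<dots> = \<bar>4 * a * r4 - 2 * s4 * t3\<bar>" by (simp add: abs_mult \<sigma>_def \<tau>_def)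
  finally have B6: "\<bar>4 * a * (\<tau> * (\<sigma> * r4)) - 2 * (\<tau> * s4) * (\<sigma> * t3)\<bar> \<le> A"
    using B2 B3 B4 by simp
  \<comment> \<open>Exchanging \<open>y\<close> and \<open>z\<close> puts the last binary
    coefficient in first place, where \<open>A\<close> is minimal.\<close>
  have C6: "A \<le> 4 * a * c4 - (\<tau> * s4)^2" using A_min[OF elem(2)[OF R6]] .
  have t6: "0 \<le> \<sigma> * t3" "\<sigma> * t3 \<le> a" using l by (auto simp: \<sigma>_def t3_def)
  have s6: "0 \<le> \<tau> * s4" "\<tau> * s4 \<le> a" using m by (auto simp: \<tau>_def s4_def)
  have "3 * a^2 \<le> 4 * a * b3 - (\<sigma> * t3)^2"
  proof -
    have "a * a \<le> a * b3" using a_min[OF elem(1)[OF R6]] A_pos by (intro mult_left_mono) auto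
    moreover have "(\<sigma> * t3)^2 \<le> a^2" using t6 by (intro power_mono)
    ultimately show ?thesis by (simp add: power2_eq_square)
  qed
  then have "reduced a b3 c4 (\<tau> * (\<sigma> * r4)) (\<tau> * s4) (\<sigma> * t3)"
    unfolding reduced_def using A_pos t6 s6 A6 B6 C6 by simp
  with R6 show ?thesis unfolding R_def by blast
qed

text \<open>All three bounds rest on \<open>\<bar>B y z\<bar> \<le> A \<bar>y z\<bar>\<close> and on
  \<open>y^2 - \<bar>y z\<bar> + z^2\<close>, which is at least 1 off the origin and at least half
  of \<open>y^2 + z^2\<close>. For the second one, \<open>C\<close> is split as
  \<open>A + (C - A)\<close> and the excess is multiplied by \<open>z^2 \<ge> 1\<close>.\<close>

lemma binary_reduced_ge:
  fixes A B C y z :: int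
  assumes "\<bar>B\<bar> \<le> A" "A \<le> C"
  shows "(y, z) \<noteq> (0, 0) \<Longrightarrow> A \<le> A * y^2 + B * y * z + C * z^2"
    and "z \<noteq> 0 \<Longrightarrow> C \<le> A * y^2 + B * y * z + C * z^2"
    and "A * (y^2 + z^2) \<le> 2 * (A * y^2 + B * y * z + C * z^2)"
proof -
  have A0: "0 \<le> A" using assms by linarith
  have "\<bar>B * y * z\<bar> \<le> A * (\<bar>y\<bar> * \<bar>z\<bar>)" 
    using assms(1) by (simp add: abs_mult mult.assoc mult_right_mono)
  then have Byz: "- (A * (\<bar>y\<bar> * \<bar>z\<bar>)) \<le> B * y * z" by linarith
  have sq: "2 * (\<bar>y\<bar> * \<bar>z\<bar>) \<le> y^2 + z^2" 
    using zero_le_power2[of "\<bar>y\<bar> - \<bar>z\<bar>"] by (simp add: power2_diff)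
  have Az: "A * z^2 \<le> C * z^2" using assms(2) by (intro mult_right_mono) auto
  show "A * (y^2 + z^2) \<le> 2 * (A * y^2 + B * y * z + C * z^2)"
    using Byz mult_left_mono[OF sq A0] Az by (simp add: algebra_simps)
  have q1: "1 \<le> y^2 - \<bar>y\<bar> * \<bar>z\<bar> + z^2" if "(y, z) \<noteq> (0, 0)"
  proof -
    have "0 < y^2 + z^2" using that by (auto simp: sum_power2_gt_zero_iff)
    with sq show ?thesis by linarith
  qed
  show "A \<le> A * y^2 + B * y * z + C * z^2" if "(y, z) \<noteq> (0, 0)"
    using mult_left_mono[OF q1[OF that] A0] Byz Az by (simp add: algebra_simps)
  show "C \<le> A * y^2 + B * y * z + C * z^2" if "z \<noteq> 0"
  proof -
    have "1 \<le> z^2" using that by (simp add: int_one_le_iff_zero_less)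
    then have "(C - A) * 1 \<le> (C - A) * z^2" using assms(2) by (intro mult_left_mono) auto
    moreover have "A * 1 \<le> A * (y^2 - \<bar>y\<bar> * \<bar>z\<bar> + z^2)" using that by (intro mult_left_mono q1 A0) auto
    ultimately show ?thesis using Byz by (simp add: algebra_simps)
  qed
qed

lemma complete_square:
  "4 * a * qf a b c r s t (x, y, z) = (2 * a * x + t * y + s * z)^2 +
     ((4 * a * b - t^2) * y^2 + (4 * a * r - 2 * s * t) * y * z + (4 * a * c - s^2) * z^2)"
  by (simp add: power2_eq_square algebra_simps)

lemma half_disc_binary:
  "16 * a * half_disc a b c r s t = 4 * (4 * a * b - t^2) * (4 * a * c - s^2) - (4 * a * r - 2 * s * t)^2"
  unfolding half_disc_def by (simp add: power2_eq_square algebra_simps)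

text \<open>For a reduced binary form, \<open>4 A C - B^2 \<ge> 3 A^2\<close>, and the left side is
  \<open>16 * a\<close> times the half-discriminant. Inserting \<open>A \<ge> 3 * a^2\<close> bounds
  \<open>a\<close> itself.\<close>

lemma reduced_bounds:
  assumes "reduced a b c r s t"
  shows "3 * (4 * a * b - t^2)^2 \<le> 16 * a * half_disc a b c r s t" "27 * a^3 \<le> 16 * half_disc a b c r s t"
proof -
  define A B C where "A = 4 * a * b - t^2" and "B = 4 * a * r - 2 * s * t" and "C = 4 * a * c - s^2"
  have h: "0 < a" "3 * a^2 \<le> A" "\<bar>B\<bar> \<le> A" "A \<le> C"
    using assms by (auto simp: reduced_def A_def B_def C_def)
  have A0: "0 \<le> A" using h by linarith
  have "B^2 \<le> A^2" using h(3) A0 abs_le_square_iff[of B A] by simp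
  moreover have "A * A \<le> A * C" using h A0 by (intro mult_left_mono)
  ultimately have "3 * A^2 \<le> 16 * a * half_disc a b c r s t"
    using half_disc_binary[of a b c r s t, folded A_def B_def C_def]
    unfolding power2_eq_square by linarith
  then show 1: "3 * (4 * a * b - t^2)^2 \<le> 16 * a * half_disc a b c r s t" by (simp add: A_def)
  have "(3 * a^2)^2 \<le> A^2" using h by (intro power_mono) auto
  then have "3 * (3 * a^2)^2 \<le> 16 * a * half_disc a b c r s t" using 1 by (simp add: A_def)
  moreover have "3 * (3 * a^2)^2 = a * (27 * a^3)" by (simp add: power2_eq_square power3_eq_cube algebra_simps)
  ultimately have "a * (27 * a^3) \<le> a * (16 * half_disc a b c r s t)" by (simp add: algebra_simps)
  then show "27 * a^3 \<le> 16 * half_disc a b c r s t" using h(1) by (simp only: mult_le_cancel_left_pos)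
qed

section \<open>Forms of given half-discriminant representing a number\<close>

text \<open>The congruence says that the form is anisotropic at \<open>p\<close>; it separates the genera of equal
  half-discriminant.\<close>

lemma ex_form_representing:
  fixes n D' p :: nat
  assumes n: "squarefree n" "\<not> p dvd n" and p: "prime p" "2 < p" and D': "0 < D'" "\<not> p dvd D'"
  shows "\<exists>a b c r s t. pos_def (qf a b c r s t) \<and> half_disc a b c r s t = int (p * D') \<and>
    int n \<in> range (qf a b c r s t) \<and>
    (\<forall>v w. int p dvd qf a b c r s t v \<longrightarrow> int p dvd qf a b c r s t (v + w) - qf a b c r s t w)"
proof -
  obtain q b e where q: "prime q" "odd q" "coprime q n" "Legendre (- int q) (int p) = -1"
    and b: "4 * int n dvd b ^ 2 + int q" and e: "int q dvd e ^ 2 + 4 * int n * int (p * D')"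
    using ex_auxiliary_prime[OF n p D'] by blast
  define N Q D where "N = int n" and "Q = int q" and "D = int (p * D')"
  have "0 < n" using n(1) by (intro Nat.gr0I) auto
  then have N0: "0 < N" by (simp add: N_def)
  have Q0: "0 < Q" using q(1) prime_gt_0_nat by (simp add: Q_def)
  have D0: "0 < D" using p D' prime_gt_0_nat by (simp add: D_def)
  have cop: "coprime Q (4 * N)"
  proof -
    have "coprime q (2 ^ 2)" using q(2) by (subst coprime_power_right_iff) simp
    then have "coprime q (4 * n)" using q(3) by simp
    then have "coprime (int q) (int (4 * n))" by (simp only: coprime_int_iff)
    then show ?thesis by (simp add: Q_def N_def)
  qed
  obtain A2 where A2: "b ^ 2 + Q = 4 * N * A2" using b by (auto simp: N_def Q_def)
  obtain C where C: "e ^ 2 + 4 * N * D = Q * C" using e by (auto simp: N_def Q_def D_def)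
  have "coprime b (4 * N)"
  proof (rule coprimeI)
    fix d assume "d dvd b" "d dvd 4 * N"
    then have "d dvd 4 * N * A2 - b * b" by (intro dvd_diff) auto
    moreover have "4 * N * A2 - b * b = Q" unfolding A2[symmetric] by (simp add: power2_eq_square)
    ultimately have "d dvd Q" by simp
    with \<open>d dvd 4 * N\<close> show "is_unit d" using cop coprime_common_divisor by blast
  qed
  then obtain x where "[b * x = 1] (mod 4 * N)" using cong_solve_coprime_int by blast
  \<comment> \<open>With \<open>x\<close> inverse to \<open>b\<close>, the product
    \<open>b * c\<close> is \<open>- e\<close> modulo \<open>4 * N\<close>. So the negative of
    \<open>Q y^2 + 2 e y z + C z^2\<close> agrees with \<open>(b y + c z)^2\<close> modulo
    \<open>4 * N\<close>; the \<open>z^2\<close> coefficients match because \<open>Q\<close> is a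
    unit and \<open>Q * C\<close> is congruent to \<open>e^2\<close>.\<close>
  define c where "c = - e * x"
  have bc: "4 * N dvd e + b * c"
  proof -
    have "4 * N dvd b * x - 1" using \<open>[b * x = 1] (mod 4 * N)\<close> by (simp add: cong_iff_dvd_diff)
    then have "4 * N dvd (- e) * (b * x - 1)" by (rule dvd_mult)
    then show ?thesis by (simp add: c_def algebra_simps)
  qed
  then obtain j where j: "e + b * c = 4 * N * j" by auto
  have "4 * N dvd Q * (C + c ^ 2)"
  proof -
    have "Q * (C + c ^ 2) = (e ^ 2 + 4 * N * D) + (4 * N * A2 - b ^ 2) * c ^ 2"
      unfolding C A2[symmetric] by (simp add: algebra_simps)
    also have "\<dots> = 4 * N * (D + A2 * c ^ 2) + (e + b * c) * (e - b * c)"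
      by (simp add: power2_eq_square algebra_simps)
    finally show ?thesis using bc by simp
  qed
  then have "4 * N dvd C + c ^ 2"
    using cop coprime_commute coprime_dvd_mult_right_iff by blast
  then obtain A3 where A3: "C + c ^ 2 = 4 * N * A3" by auto
  define F where "F = qf N A2 A3 (2 * j) c b"
  have A: "4 * N * A2 - b ^ 2 = Q" and B: "4 * N * (2 * j) - 2 * c * b = 2 * e"
    and C': "4 * N * A3 - c ^ 2 = C"
    using A2 A3 j by (simp_all add: algebra_simps)
  have hd: "half_disc N A2 A3 (2 * j) c b = D"
  proof -
    have "16 * N * half_disc N A2 A3 (2 * j) c b = 4 * Q * C - (2 * e) ^ 2"
      unfolding half_disc_binary A B C' ..
    also have "\<dots> = 4 * (Q * C) - 4 * e ^ 2" by (simp add: power_mult_distrib)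
    also have "\<dots> = 16 * N * D" unfolding C[symmetric] by simp
    finally show ?thesis using N0 by simp
  qed
  define X Y where "X v = (case v of (x, y, z) \<Rightarrow> 2 * N * x + b * y + c * z)"
    and "Y v = (case v of (x :: int, y, z) \<Rightarrow> Q * y + e * z)" for v :: "int \<times> int \<times> int"
  have add: "X (v + w) = X v + X w" "Y (v + w) = Y v + Y w" for v w
    by (cases v; cases w; simp add: X_def Y_def algebra_simps)+
  have key: "4 * N * Q * F v = Q * X v ^ 2 + Y v ^ 2 + 4 * N * D * snd (snd v) ^ 2" for v
  proof (cases v)
    case (fields x y z)
    have "4 * N * Q * F v = Q * (4 * N * F v)" by simp
    also have "4 * N * F v = X v ^ 2 + (Q * y ^ 2 + 2 * e * y * z + C * z ^ 2)"
      unfolding fields F_def complete_square A B C' by (simp add: X_def)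
    also have "Q * \<dots> = Q * X v ^ 2 + (Q * y) ^ 2 + 2 * e * Q * y * z + (Q * C) * z ^ 2"
      by (simp add: power2_eq_square algebra_simps)
    also have "\<dots> = Q * X v ^ 2 + Y v ^ 2 + 4 * N * D * snd (snd v) ^ 2"
      unfolding C[symmetric] fields Y_def by (simp add: power2_eq_square algebra_simps)
    finally show ?thesis .
  qed
  have pd: "pos_def F"
    unfolding pos_def_def
  proof (intro allI impI)
    fix v :: "int \<times> int \<times> int" assume v: "v \<noteq> 0"
    obtain x y z where xyz: "v = (x, y, z)" by (cases v)
    have "0 < Q * X v ^ 2 + Y v ^ 2 + 4 * N * D * z ^ 2"
    proof (rule ccontr)
      have nn: "0 \<le> Q * X v ^ 2" "0 \<le> Y v ^ 2" "0 \<le> 4 * N * D * z ^ 2"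
        using N0 Q0 D0 by (auto intro!: mult_nonneg_nonneg)
      assume "\<not> ?thesis"
      with nn have "Q * X v ^ 2 = 0" "Y v ^ 2 = 0" "4 * N * D * z ^ 2 = 0" by linarith+
      then have "X v = 0" "Y v = 0" "z = 0" using N0 Q0 D0 by auto
      then have "x = 0" "y = 0" "z = 0" using N0 Q0 by (auto simp: X_def Y_def xyz)
      with v show False by (simp add: xyz zero_prod_def)
    qed
    then have "0 < 4 * N * Q * F v" unfolding key by (simp add: xyz)
    moreover have "0 < 4 * N * Q" using N0 Q0 by simp
    ultimately show "0 < F v" by (rule zero_less_mult_pos)
  qed
  have pI: "prime (int p)" using p by simp
  have pD: "int p dvd D" by (simp add: D_def)
  have pQ: "\<not> int p dvd Q"
  proof
    assume "int p dvd Q"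
    then have "Legendre (- Q) (int p) = 0" by (simp add: Legendre_eq_0_iff)
    with q(4) show False by (simp add: Q_def)
  qed
  have p4NQ: "\<not> int p dvd 4 * N * Q"
  proof -
    have "\<not> int p dvd 2 ^ 2" using p pI by (subst prime_dvd_power_iff) (auto dest!: zdvd_imp_le)
    moreover have "\<not> int p dvd N" using n(2) by (simp add: N_def)
    ultimately show ?thesis using pQ pI by (simp add: prime_dvd_mult_iff)
  qed
  \<comment> \<open>Modulo \<open>p\<close>, up to the unit \<open>4 * N * Q\<close>, the form is
    \<open>Q X^2 + Y^2\<close>. This has no nontrivial zero as \<open>- Q\<close> is a nonresidue,
    so a vector whose value is divisible by \<open>p\<close> lies in the radical modulo
    \<open>p\<close>.\<close>
  have cong: "int p dvd F (v + w) - F w" if "int p dvd F v" for v w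
  proof -
    have "int p dvd 4 * N * Q * F v - 4 * N * D * snd (snd v) ^ 2" using that pD by (intro dvd_diff) auto
    then have XY: "int p dvd Q * X v ^ 2 + Y v ^ 2" unfolding key by simp
    have pX: "int p dvd X v"
    proof (rule ccontr)
      assume "\<not> ?thesis"
      then have "coprime (X v) (int p)" using pI prime_imp_coprime coprime_commute by blast
      then obtain u where "[X v * u = 1] (mod int p)" using cong_solve_coprime_int by blast
      then have "[(X v * u) ^ 2 = 1 ^ 2] (mod int p)" by (rule cong_pow)
      then have "int p dvd Q * ((X v * u) ^ 2 - 1)" by (auto simp: cong_iff_dvd_diff)
      moreover have "int p dvd u ^ 2 * (Q * X v ^ 2 + Y v ^ 2)" using XY by (rule dvd_mult)
      ultimately have "int p dvd u ^ 2 * (Q * X v ^ 2 + Y v ^ 2) - Q * ((X v * u) ^ 2 - 1)" by (intro dvd_diff)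
      then have "int p dvd (Y v * u) ^ 2 - (- Q)" by (simp add: power2_eq_square algebra_simps)
      then have "QuadRes (int p) (- Q)" unfolding QuadRes_def cong_iff_dvd_diff by blast
      with q(4) show False by (auto simp: Legendre_def Q_def split: if_splits)
    qed
    then have "int p dvd (Q * X v ^ 2 + Y v ^ 2) - Q * X v ^ 2" using XY
      by (intro dvd_diff) (auto simp: power2_eq_square)
    then have pY: "int p dvd Y v" by (simp add: prime_dvd_power_iff[OF pI])
    have "4 * N * Q * (F (v + w) - F w) = 4 * N * Q * F (v + w) - 4 * N * Q * F w"
      by (simp add: algebra_simps)
    also have "\<dots> = X v * (Q * (X v + 2 * X w)) + Y v * (Y v + 2 * Y w) +
        D * (4 * N * (snd (snd (v + w)) ^ 2 - snd (snd w) ^ 2))"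
      unfolding key add by (simp add: power2_eq_square algebra_simps)
    finally have "int p dvd 4 * N * Q * (F (v + w) - F w)" using pX pY pD by auto
    then show ?thesis using p4NQ pI prime_dvd_mult_iff by blast
  qed
  have "F (1, 0, 0) = int n" by (simp add: F_def N_def)
  then have "int n \<in> range F" by (metis rangeI)
  with pd hd cong show ?thesis unfolding F_def D_def by blast
qed

text \<open>The remaining coefficient \<open>c\<close> is determined by the half-discriminant.\<close>

definition all_reduced :: "int \<Rightarrow> (int \<times> int \<times> int \<times> int \<times> int \<times> int \<Rightarrow> bool) \<Rightarrow> bool" where
  "all_reduced D P \<longleftrightarrow>
     (\<forall>a\<in>set [1..2]. \<forall>b\<in>set [1..4]. \<forall>r\<in>set [-5..5]. \<forall>s\<in>set [0..2]. \<forall>t\<in>set [0..2].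
        let c = (D + a * r^2 + b * s^2 - r * s * t) div (4 * a * b - t^2) in
        reduced a b c r s t \<and> half_disc a b c r s t = D \<longrightarrow> P (a, b, c, r, s, t))"

text \<open>21 is the largest half-discriminant treated. It gives \<open>27 * a^3 \<le> 336\<close>,
  hence \<open>a \<le> 2\<close>, then \<open>3 * A^2 \<le> 672\<close>, hence
  \<open>A \<le> 15\<close>; the search ranges for \<open>b\<close> and \<open>r\<close>
  follow.\<close>

lemma all_reducedD:
  assumes all: "all_reduced D P" and red: "reduced a b c r s t" and D: "half_disc a b c r s t = D" "D \<le> 21"
  shows "P (a, b, c, r, s, t)"
proof -
  note h = red[unfolded reduced_def]
  define A where "A = 4 * a * b - t^2"
  have a: "a \<le> 2"
  proof (rule ccontr)
    assume "\<not> a \<le> 2"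
    then have "3 ^ 3 \<le> a ^ 3" by (intro power_mono) auto
    with reduced_bounds(2)[OF red] D show False by simp
  qed
  then have a12: "a = 1 \<or> a = 2" using h by linarith
  have A3: "3 \<le> A" using h a12 by (auto simp: A_def)
  have A15: "A \<le> 15"
  proof (rule ccontr)
    assume "\<not> A \<le> 15"
    then have "16 ^ 2 \<le> A ^ 2" by (intro power_mono) auto
    moreover have "a * half_disc a b c r s t \<le> 42" using a12 D by auto
    ultimately show False using reduced_bounds(1)[OF red] by (simp add: A_def)
  qed
  have st: "0 \<le> s" "s \<le> 2" "0 \<le> t" "t \<le> 2" using h a by auto
  have t2: "0 \<le> t^2" "t^2 \<le> 4" using power_mono[of t 2 2] st by simp_all
  have "3 \<le> 4 * a * b" "4 * a * b \<le> 19" using A3 A15 t2 unfolding A_def by linarith+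
  then have b: "1 \<le> b" "b \<le> 4" using a12 by auto
  have "0 \<le> s * t" "s * t \<le> 4" using st mult_mono[of s 2 t 2] by simp_all
  moreover have "\<bar>4 * a * r - 2 * s * t\<bar> \<le> A" using h by (simp add: A_def)
  ultimately have "- 5 \<le> r" "r \<le> 5" using a12 A15 by auto
  then have "a \<in> set [1..2]" "b \<in> set [1..4]" "r \<in> set [-5..5]" "s \<in> set [0..2]" "t \<in> set [0..2]"
    using a12 b st by auto
  moreover have "c = (D + a * r^2 + b * s^2 - r * s * t) div (4 * a * b - t^2)"
  proof -
    have "D + a * r^2 + b * s^2 - r * s * t = (4 * a * b - t^2) * c"
      using D(1) by (simp add: half_disc_def algebra_simps)
    then show ?thesis using A3 by (simp add: A_def)
  qed
  ultimately show ?thesis using all red D(1) unfolding all_reduced_def Let_def by blast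
qed

section \<open>Certificates by rational isometries\<close>

fun qft :: "int \<times> int \<times> int \<times> int \<times> int \<times> int \<Rightarrow> int \<times> int \<times> int \<Rightarrow> int" where
  "qft (a, b, c, r, s, t) v = qf a b c r s t v"

fun linear_combination :: "(int \<times> int \<times> int) \<times> (int \<times> int \<times> int) \<times> (int \<times> int \<times> int) \<Rightarrow> int \<times> int \<times> int \<Rightarrow> int \<times> int \<times> int" where
  "linear_combination ((u1, u2, u3), (v1, v2, v3), (w1, w2, w3)) (x, y, z) =
     (u1 * x + v1 * y + w1 * z, u2 * x + v2 * y + w2 * z, u3 * x + v3 * y + w3 * z)"

fun all_dvd :: "int \<Rightarrow> int \<times> int \<times> int \<Rightarrow> bool" where
  "all_dvd d (x, y, z) \<longleftrightarrow> x mod d = 0 \<and> y mod d = 0 \<and> z mod d = 0"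

text \<open>The columns \<open>u, v, w\<close> of a matrix \<open>M\<close> satisfy \<open>Q(M x) = d\<^sup>2 f(x)\<close>.\<close>

fun similitude :: "int \<Rightarrow> int \<times> int \<times> int \<times> int \<times> int \<times> int \<Rightarrow> int \<times> int \<times> int \<times> int \<times> int \<times> int \<Rightarrow>
    (int \<times> int \<times> int) \<times> (int \<times> int \<times> int) \<times> (int \<times> int \<times> int) \<Rightarrow> bool" where
  "similitude d Q (a, b, c, r, s, t) (u, v, w) \<longleftrightarrow>
     qft Q u = d * d * a \<and> qft Q v = d * d * b \<and> qft Q w = d * d * c \<and>
     qft Q (v + w) = d * d * (b + c + r) \<and> qft Q (u + w) = d * d * (a + c + s) \<and> qft Q (u + v) = d * d * (a + b + t)"

text \<open>Each \<open>M / d\<close> is a rational isometry from \<open>f\<close> to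
  \<open>Q\<close>. It need not be integral: every residue class modulo \<open>d\<close> only has to
  be sent to integer vectors by one matrix of the list. For \<open>d = 1\<close> the second
  condition is empty and one integral isometry suffices.\<close>

definition covers where
  "covers d Q f Ms \<longleftrightarrow> 0 < d \<and> (\<forall>M\<in>set Ms. similitude d Q f M) \<and>
     (\<forall>x\<in>set [0..d - 1]. \<forall>y\<in>set [0..d - 1]. \<forall>z\<in>set [0..d - 1]. \<exists>M\<in>set Ms. all_dvd d (linear_combination M (x, y, z)))"

lemma qft_linear_combination:
  assumes "similitude d Q f M"
  shows "qft Q (linear_combination M v) = d * d * qft f v"
proof -
  obtain u1 u2 u3 v1 v2 v3 w1 w2 w3 where M: "M = ((u1, u2, u3), (v1, v2, v3), (w1, w2, w3))"
    by (cases M) auto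
  obtain a b c r s t where f: "f = (a, b, c, r, s, t)" by (cases f) auto
  obtain x y z where v: "v = (x, y, z)" by (cases v) auto
  define u' v' w' where "u' = (u1, u2, u3)" and "v' = (v1, v2, v3)" and "w' = (w1, w2, w3)"
  have "qft Q (linear_combination M v) = qft Q u' * x^2 + qft Q v' * y^2 + qft Q w' * z^2
      + (qft Q (v' + w') - qft Q v' - qft Q w') * (y * z) + (qft Q (u' + w') - qft Q u' - qft Q w') * (x * z)
      + (qft Q (u' + v') - qft Q u' - qft Q v') * (x * y)"
    by (cases Q) (simp add: M v u'_def v'_def w'_def power2_eq_square algebra_simps)
  also have "\<dots> = d * d * qft f v"
    using assms unfolding M f v u'_def[symmetric] v'_def[symmetric] w'_def[symmetric]
    by (simp add: algebra_simps)
  finally show ?thesis .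
qed

lemma covers_range:
  assumes "covers d Q f Ms"
  shows "range (qft f) \<subseteq> range (qft Q)"
proof clarify
  fix x y z :: int
  have d: "0 < d" and sim: "\<And>M. M \<in> set Ms \<Longrightarrow> similitude d Q f M" using assms by (auto simp: covers_def)
  have "x mod d \<in> set [0..d - 1]" "y mod d \<in> set [0..d - 1]" "z mod d \<in> set [0..d - 1]" using d by auto
  then obtain M where M: "M \<in> set Ms" "all_dvd d (linear_combination M (x mod d, y mod d, z mod d))"
    using assms unfolding covers_def by blast
  obtain u1 u2 u3 v1 v2 v3 w1 w2 w3 where Meq: "M = ((u1, u2, u3), (v1, v2, v3), (w1, w2, w3))"
    by (cases M) auto
  have lin: "(a * x + b * y + c * z) mod d = (a * (x mod d) + b * (y mod d) + c * (z mod d)) mod d" for a b c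
  proof -
    have "[a * x + b * y + c * z = a * (x mod d) + b * (y mod d) + c * (z mod d)] (mod d)"
      by (intro cong_add cong_mult cong_refl) (simp_all add: cong_def)
    then show ?thesis by (simp only: cong_def)
  qed
  have "all_dvd d (linear_combination M (x, y, z))"
    using M(2) by (simp only: Meq all_dvd.simps linear_combination.simps lin[symmetric])
  moreover obtain l1 l2 l3 where l: "linear_combination M (x, y, z) = (l1, l2, l3)"
    using prod_cases3 by blast
  ultimately have "d dvd l1" "d dvd l2" "d dvd l3" by (simp_all add: dvd_eq_mod_eq_0)
  then obtain x' y' z' where "l1 = d * x'" "l2 = d * y'" "l3 = d * z'" by (elim dvdE)
  with l have L: "linear_combination M (x, y, z) = (d * x', d * y', d * z')" by simp
  have "d * d * qft f (x, y, z) = qft Q (d * x', d * y', d * z')"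
    using qft_linear_combination[OF sim[OF M(1)], of "(x, y, z)"] L by simp
  also have "\<dots> = d * d * qft Q (x', y', z')"
    by (cases Q) (simp add: power2_eq_square algebra_simps)
  finally have "qft f (x, y, z) = qft Q (x', y', z')" using d by simp
  then show "qft f (x, y, z) \<in> range (qft Q)" by simp
qed

text \<open>A pair \<open>(v, w)\<close> violating the anisotropy congruence at \<open>p\<close>; it
  serves to discard a reduced form.\<close>

definition congruence_fails where
  "congruence_fails p f v w \<longleftrightarrow> qft f v mod p = 0 \<and> (qft f (v + w) - qft f w) mod p \<noteq> 0"

definition certified where
  "certified p D Q certs wits \<longleftrightarrow> all_reduced D (\<lambda>f.
     (\<exists>(d, Ms)\<in>set certs. covers d Q f Ms) \<or> (\<exists>(v, w)\<in>set wits. congruence_fails p f v w))"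

theorem represents_coprime:
  fixes p D' n :: nat
  assumes cert: "certified (int p) (int (p * D')) Q certs wits"
    and p: "prime p" "2 < p" and D': "0 < D'" "\<not> p dvd D'" "p * D' \<le> 21"
    and n: "0 < n" "coprime n p"
  shows "int n \<in> range (qft Q)"
proof -
  define m k where "m = squarefree_part n" and "k = square_part n"
  have nmk: "n = m * k ^ 2" unfolding m_def k_def by (rule squarefree_decompose)
  have sq: "squarefree m" unfolding m_def by simp
  have "\<not> p dvd m"
  proof
    assume "p dvd m"
    then have "p dvd n" using nmk by simp
    then show False using n(2) p(1) by (metis coprime_absorb_right coprime_commute not_prime_unit)
  qed
  from ex_form_representing[OF sq this p D'(1,2)]
  obtain a0 b0 c0 r0 s0 t0 where F: "pos_def (qf a0 b0 c0 r0 s0 t0)"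
    "half_disc a0 b0 c0 r0 s0 t0 = int (p * D')" "int m \<in> range (qf a0 b0 c0 r0 s0 t0)"
    "\<And>v w. int p dvd qf a0 b0 c0 r0 s0 t0 v \<Longrightarrow> int p dvd qf a0 b0 c0 r0 s0 t0 (v + w) - qf a0 b0 c0 r0 s0 t0 w"
    by blast
  obtain a b c r s t where red: "reduced a b c r s t" and e: "eqv (qf a0 b0 c0 r0 s0 t0) (qf a b c r s t)"
    and hd: "half_disc a b c r s t = int (p * D')"
    using ex_reduced[OF F(1)] F(2) by auto
  define f where "f = (a, b, c, r, s, t)"
  have qf: "qft f = qf a b c r s t" by (simp add: f_def fun_eq_iff)
  have "int (p * D') \<le> 21" using D'(3) by linarith
  from all_reducedD[OF cert[unfolded certified_def] red hd this]
  have "(\<exists>(d, Ms)\<in>set certs. covers d Q f Ms) \<or> (\<exists>(v, w)\<in>set wits. congruence_fails (int p) f v w)"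
    by (simp only: f_def)
  \<comment> \<open>The congruence survives equivalence, so a reduced form with a witness cannot be
    the reduction of the constructed form.\<close>
  moreover have "\<not> congruence_fails (int p) f v w" for v w
    unfolding congruence_fails_def qf
    using eqv_congruence[OF e F(4), of v w] by (auto simp: mod_eq_0_iff_dvd)
  ultimately obtain d Ms where "covers d Q f Ms" by fast
  then have "range (qft f) \<subseteq> range (qft Q)" by (rule covers_range)
  then have "int m \<in> range (qft Q)" using F(3) eqv_range[OF e] qf by auto
  then obtain x y z where xyz: "int m = qft Q (x, y, z)" by (metis rangeE prod.exhaust)
  have "int n = qft Q (int k * x, int k * y, int k * z)"
    unfolding nmk of_nat_mult of_nat_power xyz by (cases Q) (simp add: power2_eq_square algebra_simps)
  then show ?thesis by simp
qed

section \<open>Evaluation of the certificates\<close>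

lemma certified_5: "certified 5 5 (1, 2, 7, 1, 5, 0)
    [(1, [((-2, 0, 1), (1, 0, 0), (0, 1, 0))]),
      (1, [((-3, 0, 1), (-2, 0, 1), (0, 1, 0))])]
    []"
  by code_simp

lemma represents_5:
  assumes "0 < n" "coprime n 5"
  shows "int n \<in> range (qft (1, 2, 7, 1, 5, 0))"
  using assms certified_5 by (intro represents_coprime[of 5 1]) simp_all

lemma certified_7: "certified 7 7 (1, 2, 5, 1, 4, 0)
    [(1, [((-1, 0, 0), (-2, 0, 1), (0, -1, 0))]),
      (1, [((-2, 0, 1), (-1, 0, 0), (0, 1, 0))]),
      (1, [((-1, 0, 0), (-2, 0, 1), (0, 1, 0))])]
    []"
  by code_simp

lemma represents_7:
  assumes "0 < n" "coprime n 7"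
  shows "int n \<in> range (qft (1, 2, 5, 1, 4, 0))"
  using assms certified_7 by (intro represents_coprime[of 7 1]) simp_all

text \<open>The entries with \<open>d = 2\<close> belong to reduced forms extending
  \<open>x^2 + x*y + y^2\<close>. They are not equivalent to the target, which represents 1 only
  four times. The same kind of forms requires \<open>d = 2\<close> for half-discriminants 15 and
  17.\<close>

lemma certified_11: "certified 11 11 (1, 1, 3, 0, 1, 0)
    [(1, [((0, -1, 0), (-1, 0, 0), (0, 0, 1))]),
      (1, [((-1, 0, 0), (0, -1, 0), (0, 0, -1))]),
      (2, [((0, -1, -1), (0, 1, -1), (4, -1, -1)), ((0, -1, -1), (0, -2, 0), (-4, 0, 0)), ((0, -2, 0), (-1, -1, 1), (-3, -1, -1))]),
      (1, [((0, -1, 0), (-1, 0, 0), (0, 0, -1))]),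
      (2, [((0, -1, -1), (0, 1, -1), (-4, 0, 0)), ((-1, -1, 1), (0, -2, 0), (3, -1, 1)), ((0, -2, 0), (-1, -1, 1), (3, -1, 1))])]
    []"
  by code_simp

lemma represents_11:
  assumes "0 < n" "coprime n 11"
  shows "int n \<in> range (qft (1, 1, 3, 0, 1, 0))"
  using assms certified_11 by (intro represents_coprime[of 11 1]) simp_all

lemma certified_13: "certified 13 13 (1, 2, 5, 3, 3, 0)
    [(1, [((-1, 0, 0), (1, 1, -1), (0, -1, 0))]),
      (1, [((-1, 0, 0), (1, 1, -1), (0, 1, 0))])]
    []"
  by code_simp

lemma represents_13:
  assumes "0 < n" "coprime n 13"
  shows "int n \<in> range (qft (1, 2, 5, 3, 3, 0))"
  using assms certified_13 by (intro represents_coprime[of 13 1]) simp_all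

lemma certified_17: "certified 17 17 (1, 2, 3, 2, 1, 1)
    [(2, [((-2, 0, 0), (-1, 1, -1), (1, -3, -1)), ((-1, -1, 1), (-2, 0, 0), (-2, 2, 2)), ((-1, -1, 1), (1, -1, 1), (1, -3, -1))]),
      (2, [((-2, 0, 0), (-1, -1, 1), (1, -3, -1)), ((-1, -1, 1), (-2, 0, 0), (1, -3, -1)), ((-1, -1, 1), (1, -1, 1), (-2, 2, 2))]),
      (1, [((-1, 0, 0), (-1, 1, 0), (0, 0, -1))]),
      (1, [((-1, 0, 0), (0, -1, 0), (0, 0, -1))])]
    []"
  by code_simp

lemma represents_17:
  assumes "0 < n" "coprime n 17"
  shows "int n \<in> range (qft (1, 2, 3, 2, 1, 1))"
  using assms certified_17 by (intro represents_coprime[of 17 1]) simp_all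

text \<open>Here reduced forms such as \<open>x^2 + y^2 + 3*z^2 + y*z + x*z\<close> have the right
  half-discriminant but are isotropic at 5; the witness pair removes them.\<close>

lemma certified_10: "certified 5 10 (1, 2, 3, 3, 2, 1)
    [(1, [((-1, 0, 0), (0, -1, 0), (0, 1, -1))]),
      (1, [((-1, 0, 0), (-1, -1, 1), (0, -1, 0))])]
    [((-1, 0, -1), (1, 0, 0))]"
  by code_simp

lemma represents_10:
  assumes "0 < n" "coprime n 5"
  shows "int n \<in> range (qft (1, 2, 3, 3, 2, 1))"
  using assms certified_10 by (intro represents_coprime[of 5 2]) simp_all

lemma certified_15: "certified 5 15 (1, 2, 7, 3, 4, 0)
    [(2, [((-1, 0, 1), (2, 0, 0), (-4, -4, 2)), ((-3, 0, 1), (-1, 0, 1), (-4, -4, 2)), ((-2, 0, 0), (1, 0, -1), (-4, -4, 2))]),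
      (1, [((-1, 0, 0), (-2, -1, 1), (0, 1, 0))]),
      (1, [((-1, 0, 0), (-2, -1, 1), (0, -1, 0))])]
    [((-1, 0, -1), (1, 0, 0)), ((0, -1, -1), (1, 0, 0))]"
  by code_simp

lemma represents_15:
  assumes "0 < n" "coprime n 5"
  shows "int n \<in> range (qft (1, 2, 7, 3, 4, 0))"
  using assms certified_15 by (intro represents_coprime[of 5 3]) simp_all

lemma certified_21: "certified 7 21 (1, 2, 5, 1, 3, 0)
    [(1, [((-1, 0, 0), (0, 1, 0), (1, 0, -1))]),
      (1, [((-1, 0, 0), (0, -1, 0), (1, 0, -1))])]
    [((-2, -1, 0), (1, 0, 0)), ((-2, 0, -1), (1, 0, 0))]"
  by code_simp

lemma represents_21:
  assumes "0 < n" "coprime n 7"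
  shows "int n \<in> range (qft (1, 2, 5, 1, 3, 0))"
  using assms certified_21 by (intro represents_coprime[of 7 3]) simp_all

text \<open>The half-discriminants are 5 and 20, so every isometry \<open>M / d\<close> has
  determinant \<plusminus>1/2 and cannot be integral. Several matrices share the residue classes
  modulo \<open>d\<close>.\<close>

lemma range_20a: "range (qft (1, 2, 7, 1, 5, 0)) \<subseteq> range (qft (1, 2, 7, 2, 4, 0))"
  by (rule covers_range[of 2 _ _
    "[((-1, 0, 1), (-3, -2, 1), (-5, 0, 3)),
      ((-1, 0, 1), (3, 2, -1), (0, 0, 2)),
      ((-2, 0, 0), (0, -2, 0), (-3, 0, -1))]"])
     code_simp

lemma range_20b: "range (qft (1, 2, 7, 1, 5, 0)) \<subseteq> range (qft (1, 2, 3, 1, 0, 1))"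
  by (rule covers_range[of 4 _ _
    "[((-4, 0, 0), (2, -4, 2), (-9, -2, -1)),
      ((-4, 0, 0), (-2, 4, -2), (-10, 0, -2)),
      ((-1, -2, -1), (-1, -2, 3), (-6, -4, -2)),
      ((-1, -2, -1), (1, 2, -3), (1, -6, -3)),
      ((-2, 0, 2), (0, -4, 0), (-8, 0, 4)),
      ((-2, 0, 2), (0, 4, 0), (-2, 0, 6))]"])
     code_simp

lemma range_40: "range (qft (1, 2, 3, 3, 2, 1)) \<subseteq> range (qft (1, 2, 7, 4, 0, 0))"
  by (rule covers_range[of 4 _ _
    "[((-4, 0, 0), (-2, 0, -2), (-4, -4, 0)),
      ((-3, 0, -1), (-5, 0, 1), (-5, -4, 1)),
      ((-3, -2, 1), (-3, 2, 1), (-1, -2, 3)),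
      ((-3, -2, 1), (0, -4, 0), (-5, -2, -1)),
      ((-3, 0, -1), (2, 0, -2), (-1, 4, -3))]"])
     code_simp

section \<open>Positive ternary forms miss a small number\<close>

text \<open>A representation of \<open>n\<close> makes \<open>4 * n\<close> minus the binary form
  the square of \<open>2 * x + t * y + s * z\<close>. For \<open>n \<le> 31\<close> such a square is
  below \<open>12^2\<close>, whence the list up to 121.\<close>

fun misses :: "int \<Rightarrow> int \<Rightarrow> int \<times> int \<times> int \<times> int \<times> int \<Rightarrow> bool" where
  "misses n m (b, c, r, s, t) \<longleftrightarrow> (\<forall>y\<in>set [-m..m]. \<forall>z\<in>set [-m..m].
     4 * n - ((4 * b - t^2) * y^2 + (4 * r - 2 * s * t) * y * z + (4 * c - s^2) * z^2)
       \<notin> set [0, 1, 4, 9, 16, 25, 36, 49, 64, 81, 100, 121])"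

text \<open>An entry \<open>(n, m, fs)\<close> consists of a number \<open>n\<close>, a bound \<open>m\<close> for \<open>\<bar>y\<bar>\<close> and \<open>\<bar>z\<bar>\<close> in a representation
  of \<open>n\<close>, and coefficients \<open>(b, c, r, s, t)\<close> of forms with \<open>a = 1\<close> that do not represent \<open>n\<close>.\<close>

definition exceptions :: "(int \<times> int \<times> (int \<times> int \<times> int \<times> int \<times> int) list) list" where
  "exceptions = [
   (2, 2, [
      (1, 3, 0, 0, 1), (1, 4, 0, 0, 1), (1, 5, 0, 0, 1), (1, 3, 0, 1, 1), (1, 3, 1, 1, 1), (1, 4, 0, 1, 1),
      (1, 4, 1, 1, 1), (1, 5, 0, 1, 1), (1, 5, 1, 1, 1)]),
   (3, 2, [
      (1, 4, -1, 0, 0), (1, 4, 0, 0, 0), (1, 4, 1, 0, 0), (1, 5, -1, 0, 0), (1, 5, 0, 0, 0), (1, 5, 1, 0, 0),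
      (1, 2, -1, 1, 0), (1, 2, 1, 1, 0), (1, 4, -1, 1, 0), (1, 4, 0, 1, 0), (1, 4, 1, 1, 0),
      (1, 5, -1, 1, 0), (1, 5, 0, 1, 0), (1, 5, 1, 1, 0), (2, 4, -1, 0, 1), (2, 4, 0, 0, 1), (2, 4, 1, 0, 1),
      (2, 5, -1, 0, 1), (2, 5, 0, 0, 1), (2, 5, 1, 0, 1), (2, 4, -1, 1, 1), (2, 4, 0, 1, 1), (2, 4, 1, 1, 1),
      (2, 4, 2, 1, 1), (2, 5, -1, 1, 1), (2, 5, 0, 1, 1), (2, 5, 1, 1, 1), (2, 5, 2, 1, 1)]),
   (5, 3, [
      (2, 2, -2, 0, 0), (2, 2, 2, 0, 0), (2, 3, -2, 0, 0), (2, 3, 2, 0, 0), (2, 4, -2, 1, 0),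
      (2, 4, 0, 1, 0), (2, 4, 2, 1, 0), (2, 2, 0, 0, 1), (2, 3, -1, 0, 1), (2, 3, 1, 0, 1), (1, 2, 0, 1, 1),
      (1, 2, 1, 1, 1)]),
   (6, 4, [
      (1, 1, -1, 0, 0), (1, 1, 1, 0, 0), (1, 3, 0, 0, 0), (1, 3, -1, 1, 0), (1, 3, 1, 1, 0), (1, 1, 0, 0, 1),
      (2, 3, 0, 0, 1), (2, 2, 0, 1, 1), (2, 2, 1, 1, 1)]),
   (7, 4, [
      (1, 1, 0, 0, 0), (2, 2, 0, 0, 0), (2, 4, -2, 0, 0), (2, 4, 2, 0, 0), (2, 5, -2, 0, 0), (2, 5, 2, 0, 0),
      (2, 3, -1, 1, 0), (2, 3, 1, 1, 0)]),
   (10, 5, [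
      (2, 2, -1, 0, 0), (2, 2, 1, 0, 0), (2, 3, 0, 0, 0), (2, 5, 0, 0, 0), (2, 3, 0, 1, 0), (2, 5, -2, 1, 0),
      (2, 5, 0, 1, 0), (2, 5, 2, 1, 0), (1, 2, 0, 0, 1), (2, 2, -1, 1, 1), (2, 2, 2, 1, 1), (2, 3, 0, 1, 1),
      (2, 3, 1, 1, 1)]),
   (13, 5, [
      (2, 5, -1, 0, 0), (2, 5, 1, 0, 0), (2, 2, -1, 0, 1), (2, 2, 1, 0, 1)]),
   (14, 6, [
      (1, 2, 0, 0, 0), (2, 4, 0, 0, 0), (2, 3, -2, 1, 0), (2, 3, 2, 1, 0), (1, 1, 0, 1, 1), (1, 1, 1, 1, 1)]),
   (17, 6, [
      (2, 3, -1, 1, 1), (2, 3, 2, 1, 1)]),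
   (21, 7, [
      (1, 2, -1, 0, 0), (1, 2, 1, 0, 0), (1, 2, 0, 1, 0)]),
   (22, 7, [
      (1, 3, -1, 0, 0), (1, 3, 1, 0, 0), (1, 3, 0, 1, 0)]),
   (23, 7, [
      (2, 3, -1, 0, 0), (2, 3, 1, 0, 0)]),
   (29, 8, [
      (2, 4, -1, 1, 0), (2, 4, 1, 1, 0), (2, 5, -1, 1, 0), (2, 5, 1, 1, 0)]),
   (31, 9, [
      (2, 4, -1, 0, 0), (2, 4, 1, 0, 0)])]"

lemma exceptions_miss:
  "\<forall>(n, m, fs)\<in>set exceptions. 0 \<le> m \<and> n \<le> 31 \<and> 8 * n < 3 * (m + 1)^2 \<and>
     n \<in> set [2, 3, 5, 6, 7, 10, 13, 14, 17, 21, 22, 23, 29, 31] \<and> (\<forall>f\<in>set fs. misses n m f)"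
  by code_simp

lemma exceptions_complete:
  "\<forall>b\<in>set [1..2]. \<forall>c\<in>set [1..5]. \<forall>r\<in>set [-2..2]. \<forall>s\<in>set [0..1]. \<forall>t\<in>set [0..1].
     reduced 1 b c r s t \<longrightarrow> (\<exists>(n, m, fs)\<in>set exceptions. (b, c, r, s, t) \<in> set fs)"
  by code_simp

lemma misses_not_represented:
  assumes red: "reduced 1 b c r s t" and miss: "misses n m (b, c, r, s, t)"
    and m: "0 \<le> m" "8 * n < 3 * (m + 1)^2" and n: "n \<le> 31"
  shows "n \<notin> range (qf 1 b c r s t)"
proof
  assume "n \<in> range (qf 1 b c r s t)"
  then obtain x y z where xyz: "qf 1 b c r s t (x, y, z) = n" by (metis rangeE prod.exhaust)
  define A B C where "A = 4 * b - t^2" and "B = 4 * r - 2 * s * t" and "C = 4 * c - s^2"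
  define h where "h = A * y^2 + B * y * z + C * z^2"
  have red': "3 \<le> A" "\<bar>B\<bar> \<le> A" "A \<le> C" using red by (simp_all add: reduced_def A_def B_def C_def)
  have X: "4 * n = (2 * x + t * y + s * z)^2 + h"
    using complete_square[of 1 b c r s t x y z] xyz by (simp add: h_def A_def B_def C_def)
  have "A * (y^2 + z^2) \<le> 2 * h" unfolding h_def using red' by (intro binary_reduced_ge(3))
  moreover have "3 * (y^2 + z^2) \<le> A * (y^2 + z^2)" using red'(1) by (intro mult_right_mono) auto
  moreover have "3 * y^2 + 3 * z^2 = 3 * (y^2 + z^2)" by simp
  \<comment> \<open>Together with \<open>h \<le> 4 * n\<close> this gives
    \<open>3 * (y^2 + z^2) \<le> 8 * n\<close>, the origin of the condition
    \<open>8 * n < 3 * (m + 1)^2\<close> on the box size.\<close>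
  ultimately have yz: "3 * y^2 + 3 * z^2 \<le> 2 * h" by linarith
  have "h \<le> 4 * n" using X zero_le_power2[of "2 * x + t * y + s * z"] by linarith
  with yz m(2) have "3 * y^2 + 3 * z^2 < 3 * (m + 1)^2" by linarith
  then have "y^2 < (m + 1)^2" "z^2 < (m + 1)^2"
    using zero_le_power2[of y] zero_le_power2[of z] by linarith+
  then have "\<bar>y\<bar> < m + 1" "\<bar>z\<bar> < m + 1"
    using power2_less_imp_less[of "\<bar>y\<bar>" "m + 1"] power2_less_imp_less[of "\<bar>z\<bar>" "m + 1"] m(1) by simp_all
  then have "y \<in> set [-m..m]" "z \<in> set [-m..m]" by auto
  with miss have *: "4 * n - h \<notin> set [0, 1, 4, 9, 16, 25, 36, 49, 64, 81, 100, 121]"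
    unfolding misses.simps h_def A_def B_def C_def by blast
  define X where "X = \<bar>2 * x + t * y + s * z\<bar>"
  have X2: "X^2 = 4 * n - h" using X by (simp add: X_def)
  have "0 \<le> h" using yz zero_le_power2[of y] zero_le_power2[of z] by linarith
  then have "X^2 < 12^2" using X2 n by simp
  then have "X < 12" by (rule power2_less_imp_less) simp
  moreover have "0 \<le> X" by (simp add: X_def)
  ultimately have "X \<in> {0..11}" by simp
  also have "{0..11} = set [0..11]" by simp
  also have "[0..11] = [0, 1, 2, 3, 4, 5, 6, 7, 8, 9, 10, 11 :: int]" by code_simp
  finally have "X^2 \<in> set [0, 1, 4, 9, 16, 25, 36, 49, 64, 81, 100, 121]" by auto
  with * X2 show False by simp
qed

theorem no_ternary_form_represents:
  assumes pd: "pos_def (qf a0 b0 c0 r0 s0 t0)"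
    and rep: "{1, 2, 3, 5, 6, 7, 10, 13, 14, 17, 21, 22, 23, 29, 31} \<subseteq> range (qf a0 b0 c0 r0 s0 t0)"
  shows False
proof -
  obtain a b c r s t where red: "reduced a b c r s t" and e: "eqv (qf a0 b0 c0 r0 s0 t0) (qf a b c r s t)"
    using ex_reduced[OF pd] by blast
  have rep': "n \<in> range (qf a b c r s t)"
    if "n \<in> {1, 2, 3, 5, 6, 7, 10, 13, 14, 17, 21, 22, 23, 29, 31}" for n
    using rep eqv_range[OF e] that by blast
  define A B C where "A = 4 * a * b - t^2" and "B = 4 * a * r - 2 * s * t" and "C = 4 * a * c - s^2"
  note ABC = A_def[symmetric] B_def[symmetric] C_def[symmetric]
  have h: "0 < a" "3 * a^2 \<le> A" "\<bar>B\<bar> \<le> A" "A \<le> C" "0 \<le> s" "s \<le> a" "0 \<le> t" "t \<le> a"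
    using red by (simp_all add: reduced_def A_def B_def C_def)
  have repE: "\<exists>x y z. 4 * a * n = (2 * a * x + t * y + s * z)^2 + (A * y^2 + B * y * z + C * z^2) \<and>
      qf a b c r s t (x, y, z) = n" if n: "n \<in> range (qf a b c r s t)" for n
  proof -
    obtain x y z where "qf a b c r s t (x, y, z) = n" using n by (metis rangeE prod.exhaust)
    then show ?thesis using complete_square[of a b c r s t x y z] unfolding ABC by blast
  qed
  have a1: "a = 1"
  proof -
    obtain x y z where xyz: "4 * a * 1 = (2 * a * x + t * y + s * z)^2 + (A * y^2 + B * y * z + C * z^2)"
      "qf a b c r s t (x, y, z) = 1" using repE[OF rep'[of 1]] by auto
    show ?thesis
    proof (cases "(y, z) = (0, 0)")
      case True
      then have "a * x^2 = 1" using xyz(2) by simp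
      then show ?thesis using h(1) by (auto simp: zmult_eq_1_iff)
    next
      case False
      have "A \<le> 4 * a"
        using binary_reduced_ge(1)[OF h(3,4) False] xyz(1) zero_le_power2[of "2 * a * x + t * y + s * z"]
        by linarith
      with h(2) have "a * (3 * a) \<le> a * 4" by (simp add: power2_eq_square)
      then show ?thesis using h(1) by simp
    qed
  qed
  have A8: "A \<le> 8"
  proof -
    obtain x y z where xyz: "4 * a * 2 = (2 * a * x + t * y + s * z)^2 + (A * y^2 + B * y * z + C * z^2)"
      "qf a b c r s t (x, y, z) = 2" using repE[OF rep'[of 2]] by auto
    \<comment> \<open>With \<open>a = 1\<close>, a representation of 2 on the first axis would make
      2 a square; off that axis the binary form costs at least \<open>A\<close>.\<close>
    have "(y, z) \<noteq> (0, 0)"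
    proof
      assume "(y, z) = (0, 0)"
      define w where "w = \<bar>x\<bar>"
      have w: "w^2 = 2" using xyz(2) a1 \<open>(y, z) = (0, 0)\<close> by (simp add: w_def)
      then have "w^2 < 2^2" by simp
      then have "w < 2" by (rule power2_less_imp_less) simp
      then have "w = 0 \<or> w = 1" unfolding w_def by linarith
      with w show False by auto
    qed
    from binary_reduced_ge(1)[OF h(3,4) this] xyz(1) zero_le_power2[of "2 * a * x + t * y + s * z"]
    have "A \<le> 4 * a * 2" by linarith
    then show ?thesis using a1 by simp
  qed
  have st: "s = 0 \<or> s = 1" "t = 0 \<or> t = 1" using h a1 by auto
  have Ab: "A = 4 * b - t" using st a1 by (auto simp: A_def)
  then have b: "b = 1 \<or> b = 2" using A8 h(2) a1 st by auto
  have C20: "C \<le> 20"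
  proof (rule ccontr)
    assume C: "\<not> C \<le> 20"
    \<comment> \<open>If \<open>C\<close> exceeds 20, a vector with \<open>z \<noteq> 0\<close> has
      value above 5. Then 3 and 5 are already represented by the binary form in \<open>x\<close> and
      \<open>y\<close>.\<close>
    have bin: "\<exists>u\<in>set [-4..4]. \<exists>y\<in>set [-2..2]. 4 * n = u^2 + A * y^2" if n: "n \<in> {3, 5}" for n
    proof -
      obtain x y z where xyz: "4 * a * n = (2 * a * x + t * y + s * z)^2 + (A * y^2 + B * y * z + C * z^2)"
        using repE[OF rep'[of n]] n by auto
      have "z = 0"
      proof (rule ccontr)
        assume "z \<noteq> 0"
        from binary_reduced_ge(2)[OF h(3,4) this, of y] xyz zero_le_power2[of "2 * a * x + t * y + s * z"]
        have "C \<le> 4 * a * n" by linarith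
        with C n a1 show False by auto
      qed
      define u where "u = 2 * x + t * y"
      have u: "4 * n = u^2 + A * y^2" using xyz \<open>z = 0\<close> a1 by (simp add: u_def)
      have "3 * y^2 \<le> A * y^2" using h(2) a1 by (intro mult_right_mono) auto
      moreover have "n \<le> 5" using n by auto
      ultimately have "u^2 < 25" "y^2 < 9" using u zero_le_power2[of u] zero_le_power2[of y] by linarith+
      then have "\<bar>u\<bar> < 5" "\<bar>y\<bar> < 3"
        using power2_less_imp_less[of "\<bar>u\<bar>" 5] power2_less_imp_less[of "\<bar>y\<bar>" 3] by simp_all
      then have "u \<in> set [-4..4]" "y \<in> set [-2..2]" by auto
      with u show ?thesis by blast
    qed
    obtain u3 y3 where 3: "u3 \<in> set [-4..4]" "y3 \<in> set [-2..2]" "4 * 3 = u3^2 + A * y3^2"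
      using bin[of 3] by blast
    obtain u5 y5 where 5: "u5 \<in> set [-4..4]" "y5 \<in> set [-2..2]" "4 * 5 = u5^2 + A * y5^2"
      using bin[of 5] by blast
    \<comment> \<open>The possible \<open>A = 4 * b - t\<close> are 3, 4, 7 and 8; the corresponding
      binary forms miss 5, 3, 3 and 5.\<close>
    have no: "\<forall>u\<in>set [-4..4]. \<forall>y\<in>set [-2..2]. 4 * 5 \<noteq> u^2 + 3 * y^2 \<and> 4 * 3 \<noteq> u^2 + 4 * y^2 \<and>
        4 * 3 \<noteq> u^2 + 7 * y^2 \<and> 4 * 5 \<noteq> u^2 + 8 * (y :: int)^2"
      by code_simp
    have "A = 3 \<or> A = 4 \<or> A = 7 \<or> A = 8" using b st Ab by auto
    then show False using bspec[OF bspec[OF no 3(1)] 3(2)] bspec[OF bspec[OF no 5(1)] 5(2)] 3(3) 5(3)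
      by (elim disjE) simp_all
  qed
  have "3 \<le> C" using h a1 by simp
  then have c: "1 \<le> c" "c \<le> 5" using C20 st a1 by (auto simp: C_def)
  have "\<bar>4 * r - 2 * s * t\<bar> \<le> 8" using h(3) A8 a1 by (simp add: B_def)
  then have r: "- 2 \<le> r" "r \<le> 2" using st by auto
  have "b \<in> set [1..2]" "c \<in> set [1..5]" "r \<in> set [-2..2]" "s \<in> set [0..1]" "t \<in> set [0..1]"
    using b c r st by auto
  then obtain n m fs where fs: "(n, m, fs) \<in> set exceptions" "(b, c, r, s, t) \<in> set fs"
    using exceptions_complete red a1 by blast
  then have "0 \<le> m" "n \<le> 31" "8 * n < 3 * (m + 1)^2" "misses n m (b, c, r, s, t)"
    and n: "n \<in> set [2, 3, 5, 6, 7, 10, 13, 14, 17, 21, 22, 23, 29, 31]"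
    using exceptions_miss by blast+
  then have "n \<notin> range (qf a b c r s t)"
    unfolding a1 by (intro misses_not_represented) (use red a1 in auto)
  with n show False using rep'[of n] by auto
qed

section \<open>Real quadratic forms\<close>

lemma represents_all_coprime_toI:
  assumes rep: "\<And>n. 0 < n \<Longrightarrow> coprime n p \<Longrightarrow> int n \<in> range (qf a b c r s t)"
    and f: "\<And>x y z. f (real_of_int x) (real_of_int y) (real_of_int z) = real_of_int (qf a b c r s t (x, y, z))"
  shows "represents_all_coprime_to p (in_xyz f)"
  unfolding represents_all_coprime_to_def represents_def
proof (intro allI impI)
  fix n :: nat assume "0 < n" "coprime n p"
  from rep[OF this] obtain x y z where xyz: "int n = qf a b c r s t (x, y, z)" by (metis rangeE prod.exhaust)
  have "in_xyz f (\<chi> i. real_of_int ((vector [x, y, z] :: int ^ 3) $ i)) =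
      f (real_of_int x) (real_of_int y) (real_of_int z)"
    by (simp add: in_xyz_def vector_3)
  also have "\<dots> = real_of_int (int n)" unfolding xyz by (rule f)
  finally have "in_xyz f (\<chi> i. real_of_int ((vector [x, y, z] :: int ^ 3) $ i)) = real n" by simp
  then show "\<exists>x :: int ^ 3. in_xyz f (\<chi> i. real_of_int (x $ i)) = real n" by blast
qed

text \<open>The factor 1/2 turns the even diagonal into the integers \<open>a\<close>,
  \<open>b\<close>, \<open>c\<close>. Each off-diagonal entry occurs twice by symmetry and so
  becomes a mixed coefficient itself.\<close>

lemma integral_quadratic_form_qf:
  assumes "integral_quadratic_form (Q :: real ^ 3 \<Rightarrow> real)"
  shows "\<exists>a b c r s t. \<forall>v :: int ^ 3.
    Q (\<chi> i. real_of_int (v $ i)) = real_of_int (qf a b c r s t (v $ 1, v $ 2, v $ 3))"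
proof -
  obtain A :: "int ^ 3 ^ 3" where sym: "transpose A = A" and ev: "\<And>i. even (A $ i $ i)"
    and Q: "Q = (\<lambda>x. 1 / 2 * (x \<bullet> (map_matrix real_of_int A *v x)))"
    using assms unfolding integral_quadratic_form_def even_symmetric_matrix_def by blast
  have symD: "A $ i $ j = A $ j $ i" for i j
    using arg_cong[OF sym, of "\<lambda>M. M $ i $ j"] by (simp add: transpose_def)
  obtain a b c where abc: "A $ 1 $ 1 = 2 * a" "A $ 2 $ 2 = 2 * b" "A $ 3 $ 3 = 2 * c"
    using ev by (meson evenE)
  have "Q (\<chi> i. real_of_int (v $ i)) =
      real_of_int (qf a b c (A $ 2 $ 3) (A $ 1 $ 3) (A $ 1 $ 2) (v $ 1, v $ 2, v $ 3))" for v :: "int ^ 3"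
    unfolding Q using symD[of 2 1] symD[of 3 1] symD[of 3 2]
    by (simp add: inner_vec_def matrix_vector_mult_def sum_3 map_matrix_def abc power2_eq_square algebra_simps)
  then show ?thesis by blast
qed

lemma no_form_coprime_to:
  assumes p: "p \<in> {19, 37 :: nat}" and Q: "integral_quadratic_form (Q :: real ^ 3 \<Rightarrow> real)" "positive_definite Q"
    "represents_all_coprime_to p Q"
  shows False
proof -
  from integral_quadratic_form_qf[OF Q(1)] obtain a b c r s t where all: "\<forall>v :: int ^ 3.
      Q (\<chi> i. real_of_int (v $ i)) = real_of_int (qf a b c r s t (v $ 1, v $ 2, v $ 3))"
    by (elim exE)
  note qf = all[rule_format]
  have pd: "pos_def (qf a b c r s t)"
    unfolding pos_def_def
  proof (intro allI impI)
    fix v :: "int \<times> int \<times> int" assume v: "v \<noteq> 0"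
    obtain x y z where xyz: "v = (x, y, z)" by (cases v)
    define w :: "int ^ 3" where "w = vector [x, y, z]"
    have w: "w $ 1 = x" "w $ 2 = y" "w $ 3 = z" by (simp_all add: w_def vector_3)
    have "(\<chi> i. real_of_int (w $ i)) \<noteq> 0"
    proof
      assume "(\<chi> i. real_of_int (w $ i)) = 0"
      then have "w $ i = 0" for i by (simp add: vec_eq_iff)
      then have "x = 0" "y = 0" "z = 0" using w by metis+
      with v show False by (simp add: xyz zero_prod_def)
    qed
    then have "0 < Q (\<chi> i. real_of_int (w $ i))" using Q(2) unfolding positive_definite_def by blast
    then show "0 < qf a b c r s t v" by (simp only: qf w xyz of_int_0_less_iff)
  qed
  have rep: "int n \<in> range (qf a b c r s t)" if "0 < n" "coprime n p" for n
  proof -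
    have "represents Q n" using Q(3) that unfolding represents_all_coprime_to_def by blast
    then obtain v :: "int ^ 3" where "Q (\<chi> i. real_of_int (v $ i)) = real n"
      unfolding represents_def by (elim exE)
    then have "real_of_int (qf a b c r s t (v $ 1, v $ 2, v $ 3)) = real_of_int (int n)" by (simp only: qf of_int_of_nat_eq)
    then have "int n = qf a b c r s t (v $ 1, v $ 2, v $ 3)" by (simp only: of_int_eq_iff)
    then show ?thesis by (rule range_eqI)
  qed
  have coprime: "\<forall>n\<in>set [1, 2, 3, 5, 6, 7, 10, 13, 14, 17, 21, 22, 23, 29, 31]. \<forall>p\<in>set [19, 37].
      0 < n \<and> gcd n p = (1 :: nat)"
    by code_simp
  have "p \<in> set [19, 37]" using p by simp
  have "{1, 2, 3, 5, 6, 7, 10, 13, 14, 17, 21, 22, 23, 29, 31} \<subseteq> range (qf a b c r s t)"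
  proof
    fix m :: int assume "m \<in> {1, 2, 3, 5, 6, 7, 10, 13, 14, 17, 21, 22, 23, 29, 31}"
    then have m: "nat m \<in> set [1, 2, 3, 5, 6, 7, 10, 13, 14, 17, 21, 22, 23, 29, 31]" "int (nat m) = m"
      by auto
    from bspec[OF bspec[OF coprime m(1)] \<open>p \<in> set [19, 37]\<close>]
    have "0 < nat m" "coprime (nat m) p" by (simp_all only: coprime_iff_gcd_eq_1)
    from rep[OF this] show "m \<in> range (qf a b c r s t)" unfolding m(2) .
  qed
  with pd show False by (rule no_ternary_form_represents)
qed

lemma qft_range: "range (qft (a, b, c, r, s, t)) = range (qf a b c r s t)"
  by simp

theorem theorem3p1:
  shows
    "(\<forall>Q \<in> in_xyz ` {
        (\<lambda>x y z. x^2 + 5*x*z + 2*y^2 + y*z + 7*z^2),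
        (\<lambda>x y z. x^2 + 4*x*z + 2*y^2 + 3*y*z + 7*z^2),
        (\<lambda>x y z. x^2 + 4*x*z + 2*y^2 + 2*y*z + 7*z^2),
        (\<lambda>x y z. x^2 + 2*y^2 + 4*y*z + 7*z^2),
        (\<lambda>x y z. x^2 + x*y + 2*x*z + 2*y^2 + 3*y*z + 3*z^2),
        (\<lambda>x y z. x^2 + x*y + 2*y^2 + y*z + 3*z^2)}.
        represents_all_coprime_to 5 Q) \<and>
     (\<forall>Q \<in> in_xyz ` {
        (\<lambda>x y z. x^2 + 4*x*z + 2*y^2 + y*z + 5*z^2),
        (\<lambda>x y z. x^2 + 3*x*z + 2*y^2 + y*z + 5*z^2)}.
        represents_all_coprime_to 7 Q) \<and>
     represents_all_coprime_to 11 (in_xyz (\<lambda>x y z. x^2 + x*z + y^2 + 3*z^2)) \<and>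
     represents_all_coprime_to 13 (in_xyz (\<lambda>x y z. x^2 + 3*x*z + 2*y^2 + 3*y*z + 5*z^2)) \<and>
     represents_all_coprime_to 17 (in_xyz (\<lambda>x y z. x^2 + x*y + x*z + 2*y^2 + 2*y*z + 3*z^2)) \<and>
     (\<forall>p \<in> {19, 37}. \<not> (\<exists>Q :: real ^ 3 \<Rightarrow> real.
        integral_quadratic_form Q \<and> positive_definite Q \<and> represents_all_coprime_to p Q))"
proof (intro conjI ballI)
  fix Q assume "Q \<in> in_xyz ` {
        (\<lambda>x y z. x^2 + 5*x*z + 2*y^2 + y*z + 7*z^2),
        (\<lambda>x y z. x^2 + 4*x*z + 2*y^2 + 3*y*z + 7*z^2),
        (\<lambda>x y z. x^2 + 4*x*z + 2*y^2 + 2*y*z + 7*z^2),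
        (\<lambda>x y z. x^2 + 2*y^2 + 4*y*z + 7*z^2),
        (\<lambda>x y z. x^2 + x*y + 2*x*z + 2*y^2 + 3*y*z + 3*z^2),
        (\<lambda>x y z. x^2 + x*y + 2*y^2 + y*z + 3*z^2)}"
  then consider
      "Q = in_xyz (\<lambda>x y z. x^2 + 5*x*z + 2*y^2 + y*z + 7*z^2)"
    | "Q = in_xyz (\<lambda>x y z. x^2 + 4*x*z + 2*y^2 + 3*y*z + 7*z^2)"
    | "Q = in_xyz (\<lambda>x y z. x^2 + 4*x*z + 2*y^2 + 2*y*z + 7*z^2)"
    | "Q = in_xyz (\<lambda>x y z. x^2 + 2*y^2 + 4*y*z + 7*z^2)"
    | "Q = in_xyz (\<lambda>x y z. x^2 + x*y + 2*x*z + 2*y^2 + 3*y*z + 3*z^2)"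
    | "Q = in_xyz (\<lambda>x y z. x^2 + x*y + 2*y^2 + y*z + 3*z^2)"
    by blast
  then show "represents_all_coprime_to 5 Q"
  proof cases
    case 1
    show ?thesis unfolding 1
      by (rule represents_all_coprime_toI[OF represents_5[unfolded qft_range]]) simp_all
  next
    case 2
    show ?thesis unfolding 2
      by (rule represents_all_coprime_toI[OF represents_15[unfolded qft_range]]) simp_all
  next
    case 3
    show ?thesis unfolding 3
      by (rule represents_all_coprime_toI[OF subsetD[OF range_20a represents_5, unfolded qft_range]]) simp_all
  next
    case 4
    show ?thesis unfolding 4
      by (rule represents_all_coprime_toI[OF subsetD[OF range_40 represents_10, unfolded qft_range]]) simp_all
  next
    case 5
    show ?thesis unfolding 5
      by (rule represents_all_coprime_toI[OF represents_10[unfolded qft_range]]) simp_all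
  next
    case 6
    show ?thesis unfolding 6
      by (rule represents_all_coprime_toI[OF subsetD[OF range_20b represents_5, unfolded qft_range]]) simp_all
  qed
next
  fix Q assume "Q \<in> in_xyz ` {
        (\<lambda>x y z. x^2 + 4*x*z + 2*y^2 + y*z + 5*z^2),
        (\<lambda>x y z. x^2 + 3*x*z + 2*y^2 + y*z + 5*z^2)}"
  then consider "Q = in_xyz (\<lambda>x y z. x^2 + 4*x*z + 2*y^2 + y*z + 5*z^2)"
    | "Q = in_xyz (\<lambda>x y z. x^2 + 3*x*z + 2*y^2 + y*z + 5*z^2)"
    by blast
  then show "represents_all_coprime_to 7 Q"
  proof cases
    case 1
    show ?thesis unfolding 1
      by (rule represents_all_coprime_toI[OF represents_7[unfolded qft_range]]) simp_all
  next
    case 2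
    show ?thesis unfolding 2
      by (rule represents_all_coprime_toI[OF represents_21[unfolded qft_range]]) simp_all
  qed
next
  show "represents_all_coprime_to 11 (in_xyz (\<lambda>x y z. x^2 + x*z + y^2 + 3*z^2))"
    by (rule represents_all_coprime_toI[OF represents_11[unfolded qft_range]]) simp_all
  show "represents_all_coprime_to 13 (in_xyz (\<lambda>x y z. x^2 + 3*x*z + 2*y^2 + 3*y*z + 5*z^2))"
    by (rule represents_all_coprime_toI[OF represents_13[unfolded qft_range]]) simp_all
  show "represents_all_coprime_to 17 (in_xyz (\<lambda>x y z. x^2 + x*y + x*z + 2*y^2 + 2*y*z + 3*z^2))"
    by (rule represents_all_coprime_toI[OF represents_17[unfolded qft_range]]) simp_all
  show "\<not> (\<exists>Q :: real ^ 3 \<Rightarrow> real.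
        integral_quadratic_form Q \<and> positive_definite Q \<and> represents_all_coprime_to p Q)"
    if "p \<in> {19, 37}" for p
    using no_form_coprime_to[OF that] by blast
qed

end
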